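(* Let $N\geq 1$ be an integer and let $\mathcal{R}=\mathcal{R}_2\cap\mathcal{R}_3\subset\mathbb{R}_+^N$, where $\mathcal{R}_2$ and $\mathcal{R}_3$ are the sets defined in the context. Then $\mathcal{R}$ is a polytope, and the set $\mathcal{S}$ of sector length vectors of pure $N$-qubit states satisfies $\mathcal{S}\subset\mathcal{R}$ (inclusion, not necessarily strict).
   Context: Sector lengths. Let $\sigma_0$ be the $2\times 2$ identity and $\sigma_1,\sigma_2,\sigma_3$ the Pauli matrices. For $\boldsymbol{\mu}=(\mu_1,\dots,\mu_N)\in\{0,1,2,3\}^N$ put $\sigma_{\boldsymbol{\mu}}=\sigma_{\mu_1}\otimes\dots\otimes\sigma_{\mu_N}$, and let its weight $\mathrm{wt}(\sigma_{\boldsymbol{\mu}})$ be the number of nonzero entries of $\boldsymbol{\mu}$. For an $N$-qubit state (density matrix) $\rho$ on $(\mathbb{C}^2)^{\otimes N}$ and $0\leq m\leq N$, the sector length is $S_m(\rho)=\sum_{\mathrm{wt}(\sigma_{\boldsymbol{\mu}})=m}\mathrm{Tr}(\rho\,\sigma_{\boldsymbol{\mu}})^2$; in particular $S_0(\rho)=1$. The sector length vector is $\mathbf{S}(\rho)=(S_1(\rho),\dots,S_N(\rho))$, and $$\mathcal{S}=\{\mathbf{S}(|\psi\rangle\langle\psi|) : |\psi\rangle\in(\mathbb{C}^2)^{\otimes N},\ \langle\psi|\psi\rangle=1\}\subset\mathbb{R}_+^N,$$ where $\mathbb{R}_+^N$ is the set of vectors with nonnegative entries. For a vector $\mathbf{S}=(S_1,\dots,S_N)\in\mathbb{R}_+^N$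 set $S_0=1$. Binomial coefficients $\binom{a}{b}$ with $b<0$ or $b>a\geq 0$ are zero. The set $\mathcal{R}_1$ consists of all $\mathbf{S}\in\mathbb{R}_+^N$ such that: (i) $\sum_{m=0}^N S_m=2^N$; (ii) $0\leq\sum_{m=0}^N(-1)^mS_m\leq 2^N$ if $N$ is even, and $\sum_{m=0}^N(-1)^mS_m=0$ if $N$ is odd; (iii) for all $k=0,\dots,N$: $\frac{1}{2^{N-k}}\sum_{m=0}^{N-k}\binom{N-m}{k}S_m=\frac{1}{2^k}\sum_{m=0}^k\binom{N-m}{N-k}S_m$. The set $\mathcal{R}_2$ consists of all $\mathbf{S}\in\mathcal{R}_1$ such that for all $g=0,\dots,N$: $\frac{1}{2^N}\sum_{m=0}^N(-1)^mK_g(m,N)S_m\geq 0$, where $K_g(m,N)=\sum_{i=0}^g(-1)^i3^{g-i}\binom{m}{i}\binom{N-m}{g-i}$ (Kravchuk polynomials). The set $\mathcal{R}_3$ consists of all $\mathbf{S}\in\mathcal{R}_1$ such that for all $k=1,\dots,N$: (a) $\frac{2^k}{2^{\min(k,N-k)}}\binom{N}{k}\leq\sum_{m=0}^k\binom{N-m}{k-m}S_m\leq 2^k\binom{N}{k}$; (b) $0\leq\sum_{m=0}^k(-1)^m\binom{N-m}{k-m}S_m\leq 2^k\binom{N}{k}$; (c) $\sum_{m=0}^{\lfloor (k-1)/2\rfloor}\binom{N-2m}{k-2m}S_{2m}\leq 2^{k-2}\left(3+(-1)^k\right)\binom{N}{k}$. *)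

theory Defs
  imports "HOL-Analysis.Analysis"
begin

text \<open>
  The \<open>N\<close> qubits are the elements of a finite type \<^typ>\<open>'n\<close>, so \<open>N = CARD('n) \<ge> 1\<close>.
  The space \<open>(\<complex>\<^sup>2)\<^sup>\<otimes>\<^sup>N\<close> is given in its product basis, which is indexed by the functions
  \<open>'n \<Rightarrow> 2\<close>. In the index type \<open>2\<close> the two basis vectors of a qubit are numbered 1 and 2,
  in this order.
\<close>

definition pauli :: "4 \<Rightarrow> complex^2^2" where
  "pauli a =
    (if a = 0 then mat 1
     else if a = 1 then vector [vector [0, 1], vector [1, 0]]
     else if a = 2 then vector [vector [0, - \<i>], vector [\<i>, 0]]
     else vector [vector [1, 0], vector [0, -1]])"

text \<open>The matrix entries of a Kronecker product are the products of the entries of its factors.\<close>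

definition pauli_string :: "('n::finite \<Rightarrow> 4) \<Rightarrow> complex^('n \<Rightarrow> 2)^('n \<Rightarrow> 2)" where
  "pauli_string \<mu> = (\<chi> x y. \<Prod>i\<in>UNIV. pauli (\<mu> i) $ x i $ y i)"

definition wt :: "('n::finite \<Rightarrow> 4) \<Rightarrow> nat" where
  "wt \<mu> = card {i. \<mu> i \<noteq> 0}"

definition braket :: "complex^'k \<Rightarrow> complex^'k \<Rightarrow> complex" where
  "braket \<phi> \<psi> = (\<Sum>x\<in>UNIV. cnj (\<phi> $ x) * \<psi> $ x)"

definition ketbra :: "complex^'k \<Rightarrow> complex^'k \<Rightarrow> complex^'k^'k" where
  "ketbra \<psi> \<phi> = (\<chi> x y. \<psi> $ x * cnj (\<phi> $ y))"

text \<open>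
  The trace below is real when \<open>\<rho>\<close> is Hermitian (see \<open>trace_pauli_string_real\<close>), in
  particular for density matrices, so that taking the real part loses nothing.
\<close>

definition sector_length :: "complex^('n::finite \<Rightarrow> 2)^('n \<Rightarrow> 2) \<Rightarrow> nat \<Rightarrow> real" where
  "sector_length \<rho> m = (\<Sum>\<mu> | wt \<mu> = m. (Re (trace (\<rho> ** pauli_string \<mu>)))\<^sup>2)"

text \<open>
  Vectors \<open>(S\<^sub>1, \<dots>, S\<^sub>N)\<close> live in \<^typ>\<open>real^'n\<close>, where the index type is linearly ordered: the
  element of \<^typ>\<open>'n\<close> in position \<open>m\<close>, counted from 1, carries the component \<open>S\<^sub>m\<close>. The order
  plays no other role. The function \<open>coord\<close> incorporates the convention \<open>S\<^sub>0 = 1\<close>; it is used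
  only for \<open>m \<le> CARD('n)\<close>.
\<close>

definition position :: "'n::{finite,linorder} \<Rightarrow> nat" where
  "position i = card {j. j \<le> i}"

definition coord :: "real^'n::{finite,linorder} \<Rightarrow> nat \<Rightarrow> real" where
  "coord S m = (if m = 0 then 1 else S $ (THE i. position i = m))"

definition sector_vector ::
    "complex^('n::{finite,linorder} \<Rightarrow> 2)^('n \<Rightarrow> 2) \<Rightarrow> real^'n::{finite,linorder}" where
  "sector_vector \<rho> = (\<chi> i. sector_length \<rho> (position i))"

definition pure_sector_vectors :: "(real^'n::{finite,linorder}) set" where
  "pure_sector_vectors =
    {sector_vector (ketbra \<psi> \<psi>) | \<psi> :: complex^('n \<Rightarrow> 2). braket \<psi> \<psi> = 1}"

definition R1 :: "(real^'n::{finite,linorder}) set" where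
  "R1 = {S. let N = CARD('n); s = coord S in
    (\<forall>i. 0 \<le> S $ i) \<and>
    (\<Sum>m=0..N. s m) = 2 ^ N \<and>
    (if even N
     then 0 \<le> (\<Sum>m=0..N. (-1) ^ m * s m) \<and> (\<Sum>m=0..N. (-1) ^ m * s m) \<le> 2 ^ N
     else (\<Sum>m=0..N. (-1) ^ m * s m) = 0) \<and>
    (\<forall>k\<in>{0..N}.
      1 / 2 ^ (N - k) * (\<Sum>m=0..N - k. real ((N - m) choose k) * s m) =
      1 / 2 ^ k * (\<Sum>m=0..k. real ((N - m) choose (N - k)) * s m))}"

definition kravchuk :: "nat \<Rightarrow> nat \<Rightarrow> nat \<Rightarrow> real" where
  "kravchuk g m N =
    (\<Sum>i=0..g. (-1) ^ i * 3 ^ (g - i) * real (m choose i) * real ((N - m) choose (g - i)))"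

definition R2 :: "(real^'n::{finite,linorder}) set" where
  "R2 = {S \<in> R1. let N = CARD('n); s = coord S in
    \<forall>g\<in>{0..N}. 0 \<le> 1 / 2 ^ N * (\<Sum>m=0..N. (-1) ^ m * kravchuk g m N * s m)}"

text \<open>
  The exponent \<open>k - 2\<close> in the last condition is negative for \<open>k = 1\<close>, hence the
  integer power. For \<open>k \<ge> 1\<close> the natural number \<open>(k - 1) div 2\<close> is the floor of the
  rational quotient.
\<close>

definition R3 :: "(real^'n::{finite,linorder}) set" where
  "R3 = {S \<in> R1. let N = CARD('n); s = coord S in
    \<forall>k\<in>{1..N}.
      2 ^ k / 2 ^ min k (N - k) * real (N choose k)
        \<le> (\<Sum>m=0..k. real ((N - m) choose (k - m)) * s m) \<and>
      (\<Sum>m=0..k. real ((N - m) choose (k - m)) * s m) \<le> 2 ^ k * real (N choose k) \<and>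
      0 \<le> (\<Sum>m=0..k. (-1) ^ m * real ((N - m) choose (k - m)) * s m) \<and>
      (\<Sum>m=0..k. (-1) ^ m * real ((N - m) choose (k - m)) * s m) \<le> 2 ^ k * real (N choose k) \<and>
      (\<Sum>m=0..(k - 1) div 2. real ((N - 2 * m) choose (k - 2 * m)) * s (2 * m))
        \<le> 2 powi (int k - 2) * (3 + (-1) ^ k) * real (N choose k)}"

lemma bij_betw_position:
  "bij_betw (position :: 'n::{finite,linorder} \<Rightarrow> nat) UNIV {1..CARD('n)}"
proof -
  have lt: "position i < position j" if "i < j" for i j :: 'n
  proof -
    have "{k. k \<le> i} \<subset> {k. k \<le> j}"
      using that by (intro psubsetI) (auto simp: set_eq_iff intro: exI[of _ j])
    then show ?thesis
      unfolding position_def by (intro psubset_card_mono) auto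
  qed
  have inj: "inj (position :: 'n \<Rightarrow> nat)"
    by (rule injI) (metis lt less_irrefl linorder_neqE)
  have sub: "range (position :: 'n \<Rightarrow> nat) \<subseteq> {1..CARD('n)}"
    by (auto simp: position_def Suc_le_eq card_gt_0_iff intro!: card_mono)
  have "card (range (position :: 'n \<Rightarrow> nat)) = CARD('n)"
    by (rule card_image[OF inj])
  with sub have "range (position :: 'n \<Rightarrow> nat) = {1..CARD('n)}"
    by (intro card_subset_eq) auto
  with inj show ?thesis
    by (simp add: bij_betw_def)
qed

lemma coord_position [simp]: "coord S (position i) = S $ i"
proof -
  have "position i \<in> {1..CARD('a)}"
    using bij_betw_position bij_betwE by blast
  moreover have "(THE j. position j = position i) = i"
    using bij_betw_position[where 'n='a] by (auto simp: bij_betw_def inj_def)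
  ultimately show ?thesis
    by (simp add: coord_def)
qed

lemma pauli_hermitian: "cnj (pauli a $ x $ y) = pauli a $ y $ x"
  using exhaust_2[of x] exhaust_2[of y]
  by (auto simp: pauli_def mat_def vector_2)

lemma trace_pauli_string_real:
  fixes \<rho> :: "complex^('n::finite \<Rightarrow> 2)^('n \<Rightarrow> 2)"
  assumes "\<And>x y. cnj (\<rho> $ x $ y) = \<rho> $ y $ x"
  shows "trace (\<rho> ** pauli_string \<mu>) \<in> \<real>"
proof -
  have "cnj (trace (\<rho> ** pauli_string \<mu>)) =
      (\<Sum>x\<in>UNIV. \<Sum>y\<in>UNIV. \<rho> $ y $ x * pauli_string \<mu> $ x $ y)"
    by (simp add: trace_def matrix_matrix_mult_def assms pauli_string_def cnj_prod pauli_hermitian)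
  also have "\<dots> = trace (\<rho> ** pauli_string \<mu>)"
    by (subst sum.swap) (simp add: trace_def matrix_matrix_mult_def)
  finally show ?thesis
    by (simp add: Reals_cnj_iff)
qed

end

theory Submission
  imports Defs
begin

text \<open>
  For weights \<open>w\<^sub>i\<close>, the sum of \<open>\<Prod>\<^sub>i w\<^sub>i(\<mu>\<^sub>i) \<langle>\<psi>|\<sigma>\<^sub>\<mu>|\<psi>\<rangle>\<^sup>2\<close> over all \<open>\<mu>\<close> is a quartic form in \<open>\<psi>\<close> whose
  kernel is a product of one-qubit kernels \<open>\<Sum>\<^sub>a w\<^sub>i(a) \<sigma>\<^sub>a \<otimes> \<sigma>\<^sub>a\<close>. With unit weights the one-qubit
  kernel is twice the swap; with the signs \<open>\<plusminus>1\<close> of the shadow inequalities it is twice the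
  (unnormalised) projection onto a Bell state, so that these forms are sums of squares.

  The swap kernel on \<open>K\<close> gives the purity of the marginal on \<open>K\<close>; exchanging two of the four copies
  of \<open>\<psi>\<close> turns \<open>K\<close> into its complement. The singlet kernel gives the overlap of the marginal with
  its spin flip. Writing the marginal as a mixture of vectors \<open>\<phi>\<^sub>s\<close>, Bessel's inequality bounds
  \<open>|\<langle>\<phi>\<^sub>s|\<phi>\<^sub>t\<rangle>|\<^sup>2\<close>, and for odd \<open>|K|\<close> even the sum of it and the squared overlap with the spin flip of
  \<open>\<phi>\<^sub>t\<close>, which is orthogonal to \<open>\<phi>\<^sub>t\<close>. Summing over all \<open>K\<close> with \<open>k\<close> elements produces the
  binomial weights.
\<close>

section \<open>Sums of squared Pauli expectation values\<close>

text \<open>Distributivity over all functions. It lets a sum over Pauli strings, basis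
  configurations or Gram indices factorise qubit by qubit.\<close>

lemma prod_sum_fun:
  fixes g :: "'n::finite \<Rightarrow> 'j::finite \<Rightarrow> 'a::comm_semiring_1"
  shows "(\<Sum>f\<in>UNIV. \<Prod>i\<in>UNIV. g i (f i)) = (\<Prod>i\<in>UNIV. \<Sum>j\<in>UNIV. g i j)"
  using prod_sum_PiE[of "UNIV :: 'n set" "\<lambda>_. UNIV" g] by (simp add: PiE_UNIV_domain)

lemma sum_mult_sum_swap:
  fixes f g :: "'j \<Rightarrow> 'a \<Rightarrow> 'b \<Rightarrow> 'c::comm_semiring_1"
  shows "(\<Sum>j\<in>J. (\<Sum>x\<in>A. \<Sum>y\<in>B. f j x y) * (\<Sum>u\<in>C. \<Sum>v\<in>D. g j u v)) =
    (\<Sum>x\<in>A. \<Sum>y\<in>B. \<Sum>u\<in>C. \<Sum>v\<in>D. \<Sum>j\<in>J. f j x y * g j u v)"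
  unfolding sum_distrib_right unfolding sum_distrib_left
  by (rule trans[OF sum.swap], rule sum.cong[OF refl])+ (rule refl)

definition expval :: "complex^('n::finite \<Rightarrow> 2) \<Rightarrow> ('n \<Rightarrow> 4) \<Rightarrow> real" where
  "expval \<psi> \<mu> = Re (trace (ketbra \<psi> \<psi> ** pauli_string \<mu>))"

lemma of_real_expval:
  "complex_of_real (expval \<psi> \<mu>) =
    (\<Sum>x\<in>UNIV. \<Sum>y\<in>UNIV. cnj (\<psi> $ x) * \<psi> $ y * (\<Prod>i\<in>UNIV. pauli (\<mu> i) $ x i $ y i))"
proof -
  have "complex_of_real (expval \<psi> \<mu>) = trace (ketbra \<psi> \<psi> ** pauli_string \<mu>)"
    unfolding expval_def
    by (intro of_real_Re trace_pauli_string_real) (simp add: ketbra_def)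
  also have "\<dots> = (\<Sum>x\<in>UNIV. \<Sum>y\<in>UNIV. cnj (\<psi> $ x) * \<psi> $ y * (\<Prod>i\<in>UNIV. pauli (\<mu> i) $ x i $ y i))"
    unfolding trace_def matrix_matrix_mult_def ketbra_def pauli_string_def
    by (subst sum.swap) (simp add: mult_ac)
  finally show ?thesis .
qed

text \<open>The indices \<open>x\<close>, \<open>u\<close> belong to the two bras and
  \<open>y\<close>, \<open>v\<close> to the two kets, so \<open>W i\<close> acts on the two copies
  of qubit \<open>i\<close>, from \<open>(y, v)\<close> to \<open>(x, u)\<close>.\<close>

definition quad :: "complex^('n::finite \<Rightarrow> 2) \<Rightarrow> ('n \<Rightarrow> 2 \<Rightarrow> 2 \<Rightarrow> 2 \<Rightarrow> 2 \<Rightarrow> complex) \<Rightarrow> complex" where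
  "quad \<psi> W = (\<Sum>x\<in>UNIV. \<Sum>y\<in>UNIV. \<Sum>u\<in>UNIV. \<Sum>v\<in>UNIV.
     cnj (\<psi> $ x) * \<psi> $ y * cnj (\<psi> $ u) * \<psi> $ v * (\<Prod>i\<in>UNIV. W i (x i) (y i) (u i) (v i)))"

text \<open>Each squared expectation value is a product of two double sums, one per copy of the
  state. As the weight is a product over the qubits, the sum over \<mu> moves inside the product
  over \<open>i\<close>.\<close>

lemma sum_expval_square:
  fixes \<psi> :: "complex^('n::finite \<Rightarrow> 2)"
  shows "complex_of_real (\<Sum>\<mu>\<in>UNIV. (\<Prod>i\<in>UNIV. w i (\<mu> i)) * (expval \<psi> \<mu>)\<^sup>2) =
    quad \<psi> (\<lambda>i a b c d. \<Sum>m\<in>UNIV. complex_of_real (w i m) * pauli m $ a $ b * pauli m $ c $ d)"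
proof -
  have "complex_of_real (\<Sum>\<mu>\<in>UNIV. (\<Prod>i\<in>UNIV. w i (\<mu> i)) * (expval \<psi> \<mu>)\<^sup>2) =
    (\<Sum>\<mu>\<in>UNIV.
      (\<Sum>x\<in>UNIV. \<Sum>y\<in>UNIV. (\<Prod>i\<in>UNIV. complex_of_real (w i (\<mu> i))) *
         (cnj (\<psi> $ x) * \<psi> $ y * (\<Prod>i\<in>UNIV. pauli (\<mu> i) $ x i $ y i))) *
      (\<Sum>u\<in>UNIV. \<Sum>v\<in>UNIV. cnj (\<psi> $ u) * \<psi> $ v * (\<Prod>i\<in>UNIV. pauli (\<mu> i) $ u i $ v i)))"
    unfolding of_real_sum of_real_mult of_real_power of_real_expval power2_eq_square of_real_prod
    by (intro sum.cong refl) (simp only: mult.assoc flip: sum_distrib_left)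
  also have "\<dots> = quad \<psi> (\<lambda>i a b c d. \<Sum>m\<in>UNIV. complex_of_real (w i m) * pauli m $ a $ b * pauli m $ c $ d)"
    unfolding quad_def prod_sum_fun[symmetric]
    by (subst sum_mult_sum_swap) (simp add: sum_distrib_left prod.distrib mult_ac)
  finally show ?thesis .
qed

lemma quad_scale:
  "quad \<psi> (\<lambda>i a b c d. k i * W i a b c d) = (\<Prod>i\<in>UNIV. k i) * quad \<psi> W"
  unfolding quad_def by (simp add: prod.distrib sum_distrib_left mult_ac)

text \<open>If each one-qubit kernel is a sum of terms \<open>r * cnj r\<close>, expanding the
  product gives one such term for every function \<open>j\<close>, and each contributes a squared
  modulus.\<close>

lemma gram:
  fixes F :: "('n::finite \<Rightarrow> 2) \<Rightarrow> ('n \<Rightarrow> 2) \<Rightarrow> complex" and r :: "'n \<Rightarrow> 'j::finite \<Rightarrow> 2 \<Rightarrow> 2 \<Rightarrow> complex"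
  shows "(\<Sum>x\<in>UNIV. \<Sum>v\<in>UNIV. \<Sum>y\<in>UNIV. \<Sum>u\<in>UNIV. F x v * cnj (F y u) *
       (\<Prod>i\<in>UNIV. \<Sum>j\<in>UNIV. r i j (x i) (v i) * cnj (r i j (y i) (u i)))) =
     of_real (\<Sum>j\<in>UNIV. (cmod (\<Sum>x\<in>UNIV. \<Sum>v\<in>UNIV. F x v * (\<Prod>i\<in>UNIV. r i (j i) (x i) (v i))))\<^sup>2)"
proof -
  have "of_real (\<Sum>j\<in>UNIV. (cmod (\<Sum>x\<in>UNIV. \<Sum>v\<in>UNIV. F x v * (\<Prod>i\<in>UNIV. r i (j i) (x i) (v i))))\<^sup>2)
    = (\<Sum>j\<in>UNIV. (\<Sum>x\<in>UNIV. \<Sum>v\<in>UNIV. F x v * (\<Prod>i\<in>UNIV. r i (j i) (x i) (v i))) *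
        (\<Sum>y\<in>UNIV. \<Sum>u\<in>UNIV. cnj (F y u) * (\<Prod>i\<in>UNIV. cnj (r i (j i) (y i) (u i)))))"
    unfolding of_real_sum complex_norm_square by (simp add: cnj_sum cnj_prod)
  also have "\<dots> = (\<Sum>x\<in>UNIV. \<Sum>v\<in>UNIV. \<Sum>y\<in>UNIV. \<Sum>u\<in>UNIV. F x v * cnj (F y u) *
       (\<Prod>i\<in>UNIV. \<Sum>j\<in>UNIV. r i j (x i) (v i) * cnj (r i j (y i) (u i))))"
    unfolding prod_sum_fun[symmetric]
    by (subst sum_mult_sum_swap) (simp add: sum_distrib_left prod.distrib mult_ac)
  finally show ?thesis by simp
qed

section \<open>Bell states and the one-qubit kernels\<close>

definition eps :: "complex^2^2" where
  "eps = vector [vector [0, 1], vector [-1, 0]]"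

text \<open>The coefficient matrices of the four Bell states, up to phase and norm; \<open>bell 0\<close> is the singlet.\<close>

definition bell :: "4 \<Rightarrow> complex^2^2" where
  "bell b = pauli b ** eps"

text \<open>The sign with which \<open>pauli a\<close> and \<open>pauli b\<close> commute.\<close>

definition chi :: "4 \<Rightarrow> 4 \<Rightarrow> real" where
  "chi a b = (if a = 0 \<or> b = 0 \<or> a = b then 1 else -1)"

lemma pauli_index_sum: "(\<Sum>m\<in>(UNIV::4 set). f m) = f 0 + f 1 + f 2 + f 3"
proof -
  \<comment> \<open>The type is enumerated as 1, 2, 3, 4 by \<open>sum_4\<close>; its last element
    is the Pauli index 0.\<close>
  have "(4::4) = 0" by simp
  then show ?thesis by (simp only: sum_4 ac_simps)
qed

lemma pauli_index_cases: "(b::4) = 0 \<or> b = 1 \<or> b = 2 \<or> b = 3"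
proof -
  have "(4::4) = 0" by simp
  then show ?thesis using exhaust_4[of b] by metis
qed

lemma pauli_entries:
  "pauli 0 $ x $ y = of_bool (x = y)"
  "pauli 1 $ x $ y = of_bool (x \<noteq> y)"
  "pauli 2 $ x $ y = (if x = y then 0 else if x = 1 then - \<i> else \<i>)"
  "pauli 3 $ x $ y = (if x \<noteq> y then 0 else if x = 1 then 1 else -1)"
  using exhaust_2[of x] exhaust_2[of y]
  by (auto simp: pauli_def mat_def vector_2)

lemma bell_entries:
  "bell 0 $ x $ y = (if x = y then 0 else if x = 1 then 1 else -1)"
  "bell 1 $ x $ y = (if x \<noteq> y then 0 else if x = 1 then -1 else 1)"
  "bell 2 $ x $ y = \<i> * of_bool (x = y)"
  "bell 3 $ x $ y = of_bool (x \<noteq> y)"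
  using exhaust_2[of x] exhaust_2[of y]
  by (auto simp: bell_def matrix_matrix_mult_def sum_2 eps_def vector_2 pauli_entries)

lemma pauli_swap:
  "(\<Sum>m\<in>UNIV. pauli m $ x $ y * pauli m $ u $ v) = 2 * of_bool (x = v) * of_bool (y = u)"
  using exhaust_2[of x] exhaust_2[of y] exhaust_2[of u] exhaust_2[of v]
  unfolding pauli_index_sum pauli_entries
  by (elim disjE; simp)

text \<open>For \<open>b = 0\<close> this is the decomposition of the singlet projection into Pauli
  operators. Conjugating the first copy by \<open>pauli b\<close> multiplies the term of
  \<open>pauli m\<close> by \<open>chi m b\<close> and turns the singlet into
  \<open>bell b\<close>.\<close>

lemma pauli_bell:
  "(\<Sum>m\<in>UNIV. complex_of_real ((if m = 0 then 1 else -1) * chi m b) * pauli m $ x $ y * pauli m $ u $ v)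
    = 2 * (bell b $ x $ u * cnj (bell b $ y $ v))"
proof -
  have "(\<Sum>m\<in>UNIV. complex_of_real ((if m = 0 then 1 else -1) * chi m b) * pauli m $ x $ y * pauli m $ u $ v)
     = of_bool (x = y \<and> u = v)
     - chi 1 b * of_bool (x \<noteq> y \<and> u \<noteq> v)
     - chi 2 b * (if x = y \<or> u = v then 0 else if x = u then -1 else 1)
     - chi 3 b * (if x \<noteq> y \<or> u \<noteq> v then 0 else if x = u then 1 else -1)"
    unfolding pauli_index_sum pauli_entries
    using exhaust_2[of x] exhaust_2[of y] exhaust_2[of u] exhaust_2[of v]
    by (elim disjE; simp add: chi_def)
  also have "\<dots> = 2 * (bell b $ x $ u * cnj (bell b $ y $ v))"
    using pauli_index_cases[of b] exhaust_2[of x] exhaust_2[of y] exhaust_2[of u] exhaust_2[of v]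
    by (elim disjE; simp add: bell_entries chi_def)

  finally show ?thesis .
qed

section \<open>Purities and overlaps with the spin flip\<close>

lemma sum_swap_13:
  "(\<Sum>y\<in>A. \<Sum>u\<in>B. \<Sum>v\<in>C. f y u v) = (\<Sum>v\<in>C. \<Sum>u\<in>B. \<Sum>y\<in>A. f y u v)"
  by (subst sum.swap, subst (2) sum.swap, subst sum.swap) (rule refl)

lemma prod_of_bool:
  "finite A \<Longrightarrow> (\<Prod>i\<in>A. of_bool (P i)) = (of_bool (\<forall>i\<in>A. P i) :: 'a::comm_semiring_1)"
  by (induction A rule: finite_induct) auto

lemma prod_if_const:
  "(\<Prod>i\<in>UNIV. if i \<in> (K :: 'n::finite set) then c else 1) = (c :: 'a::comm_semiring_1) ^ card K"
  by (simp add: prod.If_cases)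

text \<open>Here each Gram factor pairs a bra with a ket, so the squared terms are matrix elements
  of the state with itself.\<close>

lemma quad_parallel:
  fixes r :: "'n::finite \<Rightarrow> 'j::finite \<Rightarrow> 2 \<Rightarrow> 2 \<Rightarrow> complex"
  shows "quad \<psi> (\<lambda>i x y u v. \<Sum>j\<in>UNIV. r i j x v * cnj (r i j y u)) =
    of_real (\<Sum>j\<in>UNIV. (cmod (\<Sum>x\<in>UNIV. \<Sum>v\<in>UNIV. cnj (\<psi> $ x) * \<psi> $ v *
      (\<Prod>i\<in>UNIV. r i (j i) (x i) (v i))))\<^sup>2)"
  unfolding gram[symmetric, of "\<lambda>x v. cnj (\<psi> $ x) * \<psi> $ v"] quad_def
  by (rule sum.cong[OF refl], subst sum_swap_13, rule sum.cong[OF refl], subst sum.swap) (simp add: mult_ac)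

text \<open>Here the two bras are paired against the two kets, so the squared terms compare the
  state with a conjugated copy.\<close>

lemma quad_crossed:
  fixes r :: "'n::finite \<Rightarrow> 'j::finite \<Rightarrow> 2 \<Rightarrow> 2 \<Rightarrow> complex"
  shows "quad \<psi> (\<lambda>i x y u v. \<Sum>j\<in>UNIV. r i j x u * cnj (r i j y v)) =
    of_real (\<Sum>j\<in>UNIV. (cmod (\<Sum>x\<in>UNIV. \<Sum>u\<in>UNIV. cnj (\<psi> $ x) * cnj (\<psi> $ u) *
      (\<Prod>i\<in>UNIV. r i (j i) (x i) (u i))))\<^sup>2)"
  unfolding gram[symmetric, of "\<lambda>x u. cnj (\<psi> $ x) * cnj (\<psi> $ u)"] quad_def
  by (rule sum.cong[OF refl], subst sum.swap) (simp add: mult_ac)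

definition supp :: "('n \<Rightarrow> 4) \<Rightarrow> 'n set" where
  "supp \<mu> = {i. \<mu> i \<noteq> 0}"

text \<open>
  These are \<open>2\<^sup>k Tr \<rho>\<^sub>K\<^sup>2\<close> and \<open>2\<^sup>k Tr (\<rho>\<^sub>K \<rho>'\<^sub>K)\<close>, where \<open>k = |K|\<close>, \<open>\<rho>\<^sub>K\<close> is the marginal of
  \<open>|\<psi>\<rangle>\<langle>\<psi>|\<close> on \<open>K\<close>, and \<open>\<rho>'\<^sub>K\<close> its spin flip.
\<close>

definition purity :: "complex^('n::finite \<Rightarrow> 2) \<Rightarrow> 'n set \<Rightarrow> real" where
  "purity \<psi> K = (\<Sum>\<mu> | supp \<mu> \<subseteq> K. (expval \<psi> \<mu>)\<^sup>2)"

definition flip_overlap :: "complex^('n::finite \<Rightarrow> 2) \<Rightarrow> 'n set \<Rightarrow> real" where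
  "flip_overlap \<psi> K = (\<Sum>\<mu> | supp \<mu> \<subseteq> K. (-1) ^ wt \<mu> * (expval \<psi> \<mu>)\<^sup>2)"

text \<open>Outside \<open>K\<close> only \<open>pauli 0\<close> survives, and its kernel is the
  identity on both copies.\<close>

definition swap_kernel :: "'n set \<Rightarrow> 'n \<Rightarrow> 2 \<Rightarrow> 2 \<Rightarrow> 2 \<Rightarrow> 2 \<Rightarrow> complex" where
  "swap_kernel K i x y u v =
    (if i \<in> K then of_bool (x = v \<and> y = u) else of_bool (x = y \<and> u = v))"

definition flip_kernel :: "'n set \<Rightarrow> 'n \<Rightarrow> 2 \<Rightarrow> 2 \<Rightarrow> 2 \<Rightarrow> 2 \<Rightarrow> complex" where
  "flip_kernel K i x y u v =
    (if i \<in> K then bell 0 $ x $ u * cnj (bell 0 $ y $ v) else of_bool (x = y \<and> u = v))"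

lemma prod_of_bool_supp:
  fixes \<mu> :: "'n::finite \<Rightarrow> 4"
  shows "(\<Prod>i\<in>UNIV. of_bool (i \<in> K \<or> \<mu> i = 0)) = (of_bool (supp \<mu> \<subseteq> K) :: 'a::comm_semiring_1)"
proof -
  have "(\<forall>i\<in>UNIV. i \<in> K \<or> \<mu> i = 0) = (supp \<mu> \<subseteq> K)"
    by (auto simp: supp_def)
  then show ?thesis
    by (simp only: prod_of_bool finite)
qed

lemma sum_Collect_of_bool:
  fixes f :: "'a::finite \<Rightarrow> 'b::comm_semiring_1"
  shows "(\<Sum>x | P x. f x) = (\<Sum>x\<in>UNIV. of_bool (P x) * f x)"
  by (rule sum.mono_neutral_cong_left) auto

lemma prod_sign: "(\<Prod>i\<in>UNIV. if \<mu> i = 0 then 1 else -1 :: real) = (-1) ^ wt \<mu>"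
proof -
  have "(\<Prod>i\<in>UNIV. if \<mu> i = 0 then 1 else -1 :: real) = (\<Prod>i\<in>UNIV. if i \<in> {i. \<mu> i \<noteq> 0} then -1 else 1)"
    by (intro prod.cong) auto
  then show ?thesis
    unfolding prod_if_const wt_def .
qed

text \<open>The restriction \<open>supp \<mu> \<subseteq> K\<close> is itself a product of one-qubit
  weights. The completeness relation \<open>pauli_swap\<close> then yields a swap and a factor 2 for
  every qubit of \<open>K\<close>.\<close>

lemma purity_quad: "complex_of_real (purity \<psi> K) = 2 ^ card K * quad \<psi> (swap_kernel K)"
proof -
  have local_sum: "(\<Sum>m\<in>UNIV. complex_of_real (if i \<in> K then 1 else of_bool (m = 0)) * pauli m $ x $ y * pauli m $ u $ v)
     = (if i \<in> K then 2 else 1) * swap_kernel K i x y u v" for i x y u v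
  proof (cases "i \<in> K")
    case False
    then show ?thesis by (simp add: swap_kernel_def pauli_index_sum pauli_entries)
  qed (use pauli_swap[of x y u v] in \<open>simp add: swap_kernel_def\<close>)
  have "purity \<psi> K = (\<Sum>\<mu>\<in>UNIV. (\<Prod>i\<in>UNIV. if i \<in> K then 1 else of_bool (\<mu> i = 0)) * (expval \<psi> \<mu>)\<^sup>2)"
  proof -
    have "(\<Prod>i\<in>UNIV. if i \<in> K then 1 else of_bool (\<mu> i = 0)) = (of_bool (supp \<mu> \<subseteq> K) :: real)" for \<mu>
    proof -
      have "(\<Prod>i\<in>UNIV. if i \<in> K then 1 else of_bool (\<mu> i = 0)) = (\<Prod>i\<in>UNIV. of_bool (i \<in> K \<or> \<mu> i = 0) :: real)"
        by (intro prod.cong) auto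
      then show ?thesis
        by (simp only: prod_of_bool_supp)
    qed
    then show ?thesis
      by (simp only: purity_def sum_Collect_of_bool)
  qed
  also have "complex_of_real \<dots> = quad \<psi> (\<lambda>i x y u v. (if i \<in> K then 2 else 1) * swap_kernel K i x y u v)"
    using sum_expval_square[where w = "\<lambda>i m. if i \<in> K then 1 else of_bool (m = 0)" and \<psi> = \<psi>]
    by (simp only: local_sum)
  finally show ?thesis
    unfolding quad_scale by (simp add: prod_if_const)
qed

lemma flip_overlap_quad: "complex_of_real (flip_overlap \<psi> K) = 2 ^ card K * quad \<psi> (flip_kernel K)"
proof -
  have local_sum: "(\<Sum>m\<in>UNIV. complex_of_real (if i \<in> K then if m = 0 then 1 else -1 else of_bool (m = 0)) * pauli m $ x $ y * pauli m $ u $ v)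
     = (if i \<in> K then 2 else 1) * flip_kernel K i x y u v" for i x y u v
  proof (cases "i \<in> K")
    case False
    then show ?thesis by (simp add: flip_kernel_def pauli_index_sum pauli_entries)
  qed (use pauli_bell[of 0 x y u v] in \<open>simp add: flip_kernel_def chi_def\<close>)
  have "flip_overlap \<psi> K = (\<Sum>\<mu>\<in>UNIV. (\<Prod>i\<in>UNIV. if i \<in> K then if \<mu> i = 0 then 1 else -1 else of_bool (\<mu> i = 0)) * (expval \<psi> \<mu>)\<^sup>2)"
  proof -
    have "(\<Prod>i\<in>UNIV. if i \<in> K then if \<mu> i = 0 then 1 else -1 else of_bool (\<mu> i = 0)) =
      (-1) ^ wt \<mu> * (of_bool (supp \<mu> \<subseteq> K) :: real)" for \<mu>
    proof -
      have "(\<Prod>i\<in>UNIV. if i \<in> K then if \<mu> i = 0 then 1 else -1 else of_bool (\<mu> i = 0)) =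
        (\<Prod>i\<in>UNIV. (if \<mu> i = 0 then 1 else -1) * of_bool (i \<in> K \<or> \<mu> i = 0) :: real)"
        by (intro prod.cong) auto
      then show ?thesis
        by (simp only: prod.distrib prod_sign prod_of_bool_supp)
    qed
    then show ?thesis
      by (simp only: flip_overlap_def sum_Collect_of_bool mult_ac)
  qed
  also have "complex_of_real \<dots> = quad \<psi> (\<lambda>i x y u v. (if i \<in> K then 2 else 1) * flip_kernel K i x y u v)"
    using sum_expval_square[where w = "\<lambda>i m. if i \<in> K then if m = 0 then 1 else -1 else of_bool (m = 0)" and \<psi> = \<psi>]
    by (simp only: local_sum)
  finally show ?thesis
    unfolding quad_scale by (simp add: prod_if_const)
qed

lemma quad_swap_kernel_compl: "quad \<psi> (swap_kernel (- K)) = quad \<psi> (swap_kernel K)"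
proof -
  \<comment> \<open>Exchanging the ket indices \<open>y\<close> and \<open>v\<close> interchanges
    the swap and the identity kernel, while the four factors of \<psi> in \<open>quad\<close> are
    symmetric under it.\<close>
  have swap: "swap_kernel (- K) i x y u v = swap_kernel K i x v u y" for i x y u v
    by (auto simp: swap_kernel_def)
  have "quad \<psi> (swap_kernel (- K)) = (\<Sum>x\<in>UNIV. \<Sum>v\<in>UNIV. \<Sum>u\<in>UNIV. \<Sum>y\<in>UNIV.
     cnj (\<psi> $ x) * \<psi> $ y * cnj (\<psi> $ u) * \<psi> $ v * (\<Prod>i\<in>UNIV. swap_kernel K i (x i) (v i) (u i) (y i)))"
    unfolding quad_def swap by (rule sum.cong[OF refl]) (rule sum_swap_13)
  also have "\<dots> = quad \<psi> (swap_kernel K)"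
    unfolding quad_def by (simp add: mult_ac)
  finally show ?thesis .
qed

text \<open>By the Schmidt decomposition, complementary marginals of a pure state have equal purity;
  here it comes from the symmetry of the swap kernel.\<close>

lemma purity_compl: "purity \<psi> K / 2 ^ card K = purity \<psi> (- K) / 2 ^ card (- K)"
proof -
  have "complex_of_real (purity \<psi> K / 2 ^ card K) = complex_of_real (purity \<psi> (- K) / 2 ^ card (- K))"
    by (simp add: purity_quad quad_swap_kernel_compl)
  then show ?thesis
    by (simp only: of_real_eq_iff)
qed

text \<open>For fixed \<nu> the kernel is, up to a positive factor, the projection onto a product of
  Bell states, one per qubit, so the form is a squared modulus.\<close>

lemma shadow_nonneg:
  "0 \<le> (\<Sum>\<mu>\<in>UNIV. (-1) ^ wt \<mu> * (\<Prod>i\<in>UNIV. chi (\<mu> i) (\<nu> i)) * (expval \<psi> \<mu>)\<^sup>2)"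
proof -
  let ?T = "(\<Sum>\<mu>\<in>UNIV. (\<Prod>i\<in>UNIV. (if \<mu> i = 0 then 1 else -1) * chi (\<mu> i) (\<nu> i)) * (expval \<psi> \<mu>)\<^sup>2)"
  have "complex_of_real ?T = quad \<psi> (\<lambda>i x y u v. 2 * (bell (\<nu> i) $ x $ u * cnj (bell (\<nu> i) $ y $ v)))"
    using sum_expval_square[where w = "\<lambda>i m. (if m = 0 then 1 else -1) * chi m (\<nu> i)" and \<psi> = \<psi>]
    by (simp only: pauli_bell)
  \<comment> \<open>A one-element index type brings the rank-one kernel into the Gram form.\<close>
  also have "\<dots> = 2 ^ CARD('a) * quad \<psi> (\<lambda>i x y u v. \<Sum>j\<in>(UNIV::unit set). bell (\<nu> i) $ x $ u * cnj (bell (\<nu> i) $ y $ v))"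
    unfolding quad_scale by (simp add: UNIV_unit)
  also have "\<dots> = complex_of_real (2 ^ CARD('a) * (\<Sum>j\<in>(UNIV::('a \<Rightarrow> unit) set). (cmod (\<Sum>x\<in>UNIV. \<Sum>u\<in>UNIV. cnj (\<psi> $ x) * cnj (\<psi> $ u) *
      (\<Prod>i\<in>UNIV. bell (\<nu> i) $ x i $ u i)))\<^sup>2))"
    unfolding quad_crossed by simp
  finally have "?T = 2 ^ CARD('a) * (\<Sum>j\<in>(UNIV::('a \<Rightarrow> unit) set). (cmod (\<Sum>x\<in>UNIV. \<Sum>u\<in>UNIV. cnj (\<psi> $ x) * cnj (\<psi> $ u) *
      (\<Prod>i\<in>UNIV. bell (\<nu> i) $ x i $ u i)))\<^sup>2)"
    by (simp only: of_real_eq_iff)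
  also have "\<dots> \<ge> 0"
    by (intro mult_nonneg_nonneg sum_nonneg) auto
  finally show ?thesis
    by (simp add: prod.distrib prod_sign)
qed

section \<open>Upper bounds from Bessel's inequality\<close>

text \<open>Bessel's inequality for the orthogonal pair \<open>b\<close>, \<open>c\<close>, cleared
  of denominators so that both may vanish. Only an upper bound on the norm of \<open>c\<close> is
  required, which admits \<open>c = 0\<close>.\<close>

lemma bessel_two:
  fixes a b c :: "'a::finite \<Rightarrow> complex"
  assumes orth: "(\<Sum>x\<in>UNIV. cnj (b x) * c x) = 0"
    and le: "(\<Sum>x\<in>UNIV. (cmod (c x))\<^sup>2) \<le> (\<Sum>x\<in>UNIV. (cmod (b x))\<^sup>2)"
  shows "(cmod (\<Sum>x\<in>UNIV. cnj (a x) * b x))\<^sup>2 + (cmod (\<Sum>x\<in>UNIV. cnj (a x) * c x))\<^sup>2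
    \<le> (\<Sum>x\<in>UNIV. (cmod (a x))\<^sup>2) * (\<Sum>x\<in>UNIV. (cmod (b x))\<^sup>2)"
proof -
  define ip :: "('a \<Rightarrow> complex) \<Rightarrow> ('a \<Rightarrow> complex) \<Rightarrow> complex"
    where "ip f g = (\<Sum>x\<in>UNIV. cnj (f x) * g x)" for f g
  define sq :: "('a \<Rightarrow> complex) \<Rightarrow> real" where "sq f = (\<Sum>x\<in>UNIV. (cmod (f x))\<^sup>2)" for f
  have ip_self: "ip f f = of_real (sq f)" for f
    by (simp only: ip_def sq_def of_real_sum complex_norm_square mult.commute)
  have ip_cnj: "cnj (ip f g) = ip g f" for f g
    by (simp add: ip_def mult.commute)
  define n where "n = sq b"
  define B where "B = (cmod (ip a b))\<^sup>2"
  define C where "C = (cmod (ip a c))\<^sup>2"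
  have B_eq: "complex_of_real B = ip a b * ip b a" and C_eq: "complex_of_real C = ip a c * ip c a"
    unfolding B_def C_def complex_norm_square ip_cnj by (rule refl)+
  \<comment> \<open>If \<open>c\<close> has the norm of \<open>b\<close>, this is \<open>n\<close>
    times the residual of \<open>a\<close> after projection onto both vectors. Scaling by
    \<open>n\<close> avoids a division; a shorter \<open>c\<close> only adds the term
    \<open>- C * (n - sq c)\<close> below, which has a favourable sign.\<close>
  define d where "d x = of_real n * a x - ip b a * b x - ip c a * c x" for x
  have bc: "ip b c = 0"
    using orth by (simp add: ip_def)
  have cb: "ip c b = 0"
    using ip_cnj[of b c] bc by simp
  have d_left: "ip d g = of_real n * ip a g - ip a b * ip b g - ip a c * ip c g" for g
    by (simp add: ip_def d_def algebra_simps sum.distrib sum_subtractf sum_distrib_left sum_distrib_right)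
  have d_right: "ip g d = of_real n * ip g a - ip b a * ip g b - ip c a * ip g c" for g
    by (simp add: ip_def d_def algebra_simps sum.distrib sum_subtractf sum_distrib_left sum_distrib_right)
  have "complex_of_real (sq d) = of_real (n * (n * sq a - B - C) - C * (n - sq c))"
  proof -
    have "ip d d = of_real n * ip a d - ip a b * ip b d - ip a c * ip c d"
      by (rule d_left)
    also have "ip a d = of_real (n * sq a - B - C)"
      unfolding d_right by (simp add: ip_self B_eq C_eq mult.commute)
    also have "ip b d = 0"
      unfolding d_right by (simp add: bc ip_self n_def)
    also have "ip a c * ip c d = of_real (C * (n - sq c))"
      unfolding d_right by (simp add: cb ip_self C_eq algebra_simps)
    finally show ?thesis
      by (simp add: ip_self)
  qed
  then have eq: "sq d = n * (n * sq a - B - C) - C * (n - sq c)"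
    by (simp only: of_real_eq_iff)
  have nonneg: "0 \<le> sq f" for f
    by (simp add: sq_def sum_nonneg)
  have "C * (n - sq c) \<ge> 0"
    using le by (simp add: C_def n_def sq_def)
  then have ge: "0 \<le> n * (n * sq a - B - C)"
    using eq nonneg[of d] by linarith
  have "B + C \<le> sq a * n"
  proof (cases "n = 0")
    case True
    have "sq c = 0"
      using le nonneg[of c] True by (simp add: n_def sq_def)
    moreover have "sq f = 0 \<Longrightarrow> ip a f = 0" for f
      by (simp add: sq_def ip_def sum_nonneg_eq_0_iff)
    ultimately show ?thesis
      using True by (simp add: B_def C_def n_def)
  next
    case False
    then have "n > 0"
      using nonneg[of b] by (simp add: n_def)
    then have "0 \<le> n * sq a - B - C"
      using ge by (simp add: zero_le_mult_iff)
    then show ?thesis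
      by (simp add: mult.commute)
  qed
  then show ?thesis
    by (simp add: B_def C_def n_def ip_def sq_def)
qed

text \<open>
  For \<open>j = (s, t)\<close>, the product of the entries of \<open>link\<close> moves the qubits in \<open>K\<close> by \<open>e\<close>, and
  on the remaining qubits it selects the basis configuration \<open>s\<close> in \<open>x\<close> and \<open>t\<close> in \<open>v\<close>.
\<close>

definition link :: "(2 \<Rightarrow> 2 \<Rightarrow> complex) \<Rightarrow> 'n set \<Rightarrow> 'n \<Rightarrow> 2 \<times> 2 \<Rightarrow> 2 \<Rightarrow> 2 \<Rightarrow> complex" where
  "link e K i j x v = (if i \<in> K then e x v else of_bool (x = fst j \<and> v = snd j))"

abbreviation "same x v \<equiv> of_bool (x = v)"
abbreviation "flip x v \<equiv> bell 0 $ x $ v"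

lemma sum_prod2: "(\<Sum>j\<in>(UNIV::(2\<times>2) set). f j) = f (1,1) + f (1,2) + f (2,1) + f (2,2)"
  unfolding UNIV_Times_UNIV[symmetric] sum.cartesian_product' by (simp add: sum_2 add.assoc)

text \<open>Outside \<open>K\<close> the sum over \<open>j\<close> glues \<open>x\<close> to
  \<open>y\<close> and \<open>v\<close> to \<open>u\<close>. Inside \<open>K\<close> the index
  \<open>j\<close> is idle, and its four values give the factor 4.\<close>

lemma link_same_kernel:
  "(\<Sum>j\<in>UNIV. link same K i j x v * cnj (link same K i j y u)) = (if i \<in> K then 4 else 1) * swap_kernel K i x y u v"
  using exhaust_2[of x] exhaust_2[of y] exhaust_2[of u] exhaust_2[of v]
  unfolding sum_prod2 link_def swap_kernel_def
  by (elim disjE; simp)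

lemma link_flip_kernel:
  "(\<Sum>j\<in>UNIV. link flip K i j x u * cnj (link flip K i j y v)) = (if i \<in> K then 4 else 1) * flip_kernel K i x y u v"
  using exhaust_2[of x] exhaust_2[of y] exhaust_2[of u] exhaust_2[of v]
  unfolding sum_prod2 link_def flip_kernel_def bell_entries
  by (elim disjE; simp)

text \<open>The term for \<open>j = (s, t)\<close> is the squared overlap of the components of
  \<psi> on \<open>K\<close> belonging to the outer configurations \<open>s\<close> and
  \<open>t\<close>.\<close>

lemma purity_link:
  "2 ^ card K * purity \<psi> K = (\<Sum>j\<in>UNIV. (cmod (\<Sum>x\<in>UNIV. \<Sum>v\<in>UNIV. cnj (\<psi> $ x) * \<psi> $ v *
      (\<Prod>i\<in>UNIV. link same K i (j i) (x i) (v i))))\<^sup>2)"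
proof -
  have "complex_of_real (2 ^ card K * purity \<psi> K) = 4 ^ card K * quad \<psi> (swap_kernel K)"
    by (simp add: purity_quad flip: power_mult_distrib mult.assoc)
  also have "\<dots> = quad \<psi> (\<lambda>i x y u v. (if i \<in> K then 4 else 1) * swap_kernel K i x y u v)"
    unfolding quad_scale prod_if_const ..
  finally show ?thesis
    unfolding link_same_kernel[symmetric] quad_parallel by (simp only: of_real_eq_iff)
qed

lemma flip_overlap_link:
  "2 ^ card K * flip_overlap \<psi> K = (\<Sum>j\<in>UNIV. (cmod (\<Sum>x\<in>UNIV. \<Sum>u\<in>UNIV. cnj (\<psi> $ x) * cnj (\<psi> $ u) *
      (\<Prod>i\<in>UNIV. link flip K i (j i) (x i) (u i))))\<^sup>2)"
proof -
  have "complex_of_real (2 ^ card K * flip_overlap \<psi> K) = 4 ^ card K * quad \<psi> (flip_kernel K)"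
    by (simp add: flip_overlap_quad flip: power_mult_distrib mult.assoc)
  also have "\<dots> = quad \<psi> (\<lambda>i x y u v. (if i \<in> K then 4 else 1) * flip_kernel K i x y u v)"
    unfolding quad_scale prod_if_const ..
  finally show ?thesis
    unfolding link_flip_kernel[symmetric] quad_crossed by (simp only: of_real_eq_iff)
qed

lemma flip_overlap_nonneg: "0 \<le> flip_overlap \<psi> K"
proof -
  have "0 \<le> 2 ^ card K * flip_overlap \<psi> K"
    unfolding flip_overlap_link by (intro sum_nonneg) simp
  then show ?thesis
    by (simp add: zero_le_mult_iff power_le_zero_eq)
qed

section \<open>Inner products and norms of the linked vectors\<close>

lemma sum_link_product:
  fixes r s :: "'n::finite \<Rightarrow> 2 \<Rightarrow> 2 \<Rightarrow> complex"
  shows "(\<Sum>x\<in>UNIV. cnj (\<Sum>v\<in>UNIV. f v * (\<Prod>i\<in>UNIV. r i (x i) (v i))) * (\<Sum>u\<in>UNIV. g u * (\<Prod>i\<in>UNIV. s i (x i) (u i)))) =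
    (\<Sum>v\<in>UNIV. \<Sum>u\<in>UNIV. cnj (f v) * g u * (\<Prod>i\<in>UNIV. \<Sum>a\<in>UNIV. cnj (r i a (v i)) * s i a (u i)))"
  unfolding prod_sum_fun[symmetric] cnj_sum sum_product prod.distrib
  by (subst sum.swap, rule sum.cong[OF refl], subst sum.swap)
    (simp add: cnj_prod sum_distrib_left mult_ac)

text \<open>The indicator that \<open>x\<close> agrees with \<open>s\<close> outside
  \<open>K\<close>, written as a product so that it merges with \<open>link\<close> and sums
  factorise over the qubits.\<close>

definition env :: "'n::finite set \<Rightarrow> ('n \<Rightarrow> 2) \<Rightarrow> ('n \<Rightarrow> 2) \<Rightarrow> real" where
  "env K s x = (\<Prod>i\<in>UNIV. if i \<in> K then 1 else of_bool (x i = s i))"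

text \<open>Since \<open>link\<close> already selects \<open>s\<close> in \<open>x\<close>, the
  vector paired with it may be restricted to \<open>s\<close> at no cost. Bessel's inequality then
  sees the norm of the restricted vector instead of that of \<psi>.\<close>

lemma link_env:
  "env K (\<lambda>i. fst (j i)) x * (\<Prod>i\<in>UNIV. link e K i (j i) (x i) (v i)) = (\<Prod>i\<in>UNIV. link e K i (j i) (x i) (v i))"
  unfolding env_def of_real_prod prod.distrib[symmetric]
  by (rule prod.cong) (auto simp: link_def)

lemma env_square: "(env K s x)\<^sup>2 = env K s x"
  unfolding env_def prod_power_distrib by (intro prod.cong) auto

lemma sum_env_env:
  fixes x v :: "'n::finite \<Rightarrow> 2"
  shows "(\<Sum>j\<in>(UNIV :: ('n \<Rightarrow> 2 \<times> 2) set). env K (\<lambda>i. fst (j i)) x * env K (\<lambda>i. snd (j i)) v) = 4 ^ card K"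
proof -
  have "(\<Sum>t\<in>UNIV. (if i \<in> K then 1 else of_bool (x i = fst t)) * (if i \<in> K then 1 else of_bool (v i = snd t))) =
     (if i \<in> K then 4 else 1 :: real)" for i
    using exhaust_2[of "x i"] exhaust_2[of "v i"]
    unfolding sum_prod2 by (elim disjE; simp)
  then show ?thesis
    unfolding env_def prod.distrib[symmetric]
    by (subst prod_sum_fun) (simp add: prod_if_const)
qed

text \<open>The map is unitary on the qubits of \<open>K\<close> and, outside, carries the basis
  configuration \<open>t\<close> to \<open>s\<close>. It therefore preserves the norm of the part of
  \<open>f\<close> that is compatible with \<open>t\<close>.\<close>

lemma link_norm:
  fixes f :: "('n::finite \<Rightarrow> 2) \<Rightarrow> complex"
  assumes unitary: "\<And>v u. (\<Sum>a\<in>UNIV. cnj (e a v) * e a u) = of_bool (v = u)"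
  shows "(\<Sum>x\<in>UNIV. (cmod (\<Sum>v\<in>UNIV. f v * (\<Prod>i\<in>UNIV. link e K i (j i) (x i) (v i))))\<^sup>2) =
    (\<Sum>v\<in>UNIV. (cmod (f v))\<^sup>2 * env K (\<lambda>i. snd (j i)) v)"
proof -
  have local: "(\<Sum>a\<in>UNIV. cnj (link e K i (j i) a (v i)) * link e K i (j i) a (u i)) =
      of_bool (v i = u i) * complex_of_real (if i \<in> K then 1 else of_bool (v i = snd (j i)))" for i u v
  proof (cases "i \<in> K")
    case False
    then show ?thesis
      using exhaust_2[of "fst (j i)"] by (auto simp: link_def sum_2)
  qed (simp add: link_def unitary)
  have "(\<Prod>i\<in>UNIV. of_bool (v i = u i)) = (of_bool (v = u) :: complex)" for u v :: "'n \<Rightarrow> 2"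
    by (simp add: prod_of_bool fun_eq_iff)
  then have prod: "(\<Prod>i\<in>UNIV. \<Sum>a\<in>UNIV. cnj (link e K i (j i) a (v i)) * link e K i (j i) a (u i)) =
      of_bool (v = u) * complex_of_real (env K (\<lambda>i. snd (j i)) v)" for u v
    unfolding local prod.distrib env_def by simp
  have "complex_of_real (\<Sum>x\<in>UNIV. (cmod (\<Sum>v\<in>UNIV. f v * (\<Prod>i\<in>UNIV. link e K i (j i) (x i) (v i))))\<^sup>2) =
    (\<Sum>x\<in>UNIV. cnj (\<Sum>v\<in>UNIV. f v * (\<Prod>i\<in>UNIV. link e K i (j i) (x i) (v i))) *
       (\<Sum>u\<in>UNIV. f u * (\<Prod>i\<in>UNIV. link e K i (j i) (x i) (u i))))"
    unfolding of_real_sum complex_norm_square by (simp only: mult.commute)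
  also have "\<dots> = (\<Sum>v\<in>UNIV. \<Sum>u\<in>UNIV. cnj (f v) * f u * (of_bool (v = u) * complex_of_real (env K (\<lambda>i. snd (j i)) v)))"
    unfolding sum_link_product[where r = "\<lambda>i. link e K i (j i)" and s = "\<lambda>i. link e K i (j i)"] prod ..
  also have "\<dots> = (\<Sum>v\<in>UNIV. cnj (f v) * f v * complex_of_real (env K (\<lambda>i. snd (j i)) v))"
  proof (rule sum.cong[OF refl])
    fix v
    have "(\<Sum>u\<in>UNIV. cnj (f v) * f u * (of_bool (v = u) * complex_of_real (env K (\<lambda>i. snd (j i)) v))) =
      (\<Sum>u\<in>UNIV. if v = u then cnj (f v) * f v * complex_of_real (env K (\<lambda>i. snd (j i)) v) else 0)"
      by (rule sum.cong) auto
    then show "(\<Sum>u\<in>UNIV. cnj (f v) * f u * (of_bool (v = u) * complex_of_real (env K (\<lambda>i. snd (j i)) v))) =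
      cnj (f v) * f v * complex_of_real (env K (\<lambda>i. snd (j i)) v)"
      by simp
  qed
  also have "\<dots> = complex_of_real (\<Sum>v\<in>UNIV. (cmod (f v))\<^sup>2 * env K (\<lambda>i. snd (j i)) v)"
    unfolding of_real_sum of_real_mult complex_norm_square by (simp only: mult.commute)
  finally show ?thesis
    by (simp only: of_real_eq_iff)
qed

lemma same_unitary: "(\<Sum>a\<in>UNIV. cnj (same a v) * same a u) = (same v u :: complex)"
  for u v :: 2
  using exhaust_2[of u] exhaust_2[of v] unfolding sum_2 by (elim disjE; simp)

lemma flip_unitary: "(\<Sum>a\<in>UNIV. cnj (flip a v) * flip a u) = same v u"
  using exhaust_2[of u] exhaust_2[of v] unfolding sum_2 bell_entries by (elim disjE; simp)

text \<open>An odd number of singlets is antisymmetric, so a vector on \<open>K\<close> is orthogonal to its spin flip.\<close>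

lemma link_same_flip_orthogonal:
  fixes f :: "('n::finite \<Rightarrow> 2) \<Rightarrow> complex"
  assumes "odd (card K)"
  shows "(\<Sum>x\<in>UNIV. cnj (\<Sum>v\<in>UNIV. f v * (\<Prod>i\<in>UNIV. link same K i (j i) (x i) (v i))) *
       (\<Sum>u\<in>UNIV. cnj (f u) * (\<Prod>i\<in>UNIV. link flip K i (j i) (x i) (u i)))) = 0"
proof -
  \<comment> \<open>The bilinear form left after summing out \<open>x\<close>: antisymmetric on each
    qubit of \<open>K\<close>, symmetric on the others.\<close>
  define A where "A i v u = (if i \<in> K then flip v u else of_bool (v = snd (j i) \<and> u = snd (j i)))" for i v u
  have local: "(\<Sum>a\<in>UNIV. cnj (link same K i (j i) a v) * link flip K i (j i) a u) = A i v u" for i v u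
    using exhaust_2[of u] exhaust_2[of v] exhaust_2[of "fst (j i)"] exhaust_2[of "snd (j i)"] unfolding sum_2 A_def link_def bell_entries
    by (elim disjE; simp)
  have swap: "A i u v = (if i \<in> K then -1 else 1) * A i v u" for i u v
    using exhaust_2[of u] exhaust_2[of v] exhaust_2[of "snd (j i)"] unfolding A_def bell_entries by (elim disjE; simp)
  have prod_swap: "(\<Prod>i\<in>UNIV. A i (u i) (v i)) = (\<Prod>i\<in>UNIV. if i \<in> K then -1 else 1) * (\<Prod>i\<in>UNIV. A i (v i) (u i))" for u v
    unfolding prod.distrib[symmetric] by (intro prod.cong refl swap)
  have "(\<Prod>i\<in>UNIV. if i \<in> K then -1 else 1 :: complex) = -1"
    unfolding prod_if_const using assms by simp
  then have antisym: "(\<Prod>i\<in>UNIV. A i (u i) (v i)) = - (\<Prod>i\<in>UNIV. A i (v i) (u i))" for u v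
    by (metis prod_swap mult_minus1)
  let ?X = "\<Sum>v\<in>UNIV. \<Sum>u\<in>UNIV. cnj (f v) * cnj (f u) * (\<Prod>i\<in>UNIV. A i (v i) (u i))"
  have "?X = (\<Sum>v\<in>UNIV. \<Sum>u\<in>UNIV. cnj (f u) * cnj (f v) * (\<Prod>i\<in>UNIV. A i (u i) (v i)))"
    by (rule sum.swap)
  also have "\<dots> = - ?X"
  proof -
    have neg: "cnj (f u) * cnj (f v) * (\<Prod>i\<in>UNIV. A i (u i) (v i)) = - (cnj (f v) * cnj (f u) * (\<Prod>i\<in>UNIV. A i (v i) (u i)))" for u v
      unfolding antisym[of u v] by simp
    show ?thesis
      unfolding sum_negf[symmetric] by (intro sum.cong refl neg)
  qed
  finally have "?X = - ?X" .
  moreover have "z = - z \<Longrightarrow> z = 0" for z :: complex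
    by (simp add: complex_eq_iff)
  ultimately have "?X = 0"
    by blast
  then show ?thesis
    unfolding sum_link_product[where r = "\<lambda>i. link same K i (j i)" and s = "\<lambda>i. link flip K i (j i)"] local .
qed

text \<open>Summing the bounds over all \<open>j\<close> gives \<open>4 ^ card K\<close> for a
  normalised state, because every pair \<open>x\<close>, \<open>v\<close> is compatible with that
  many \<open>j\<close>. The slack \<open>h\<close> makes room for a second Bessel term.\<close>

lemma purity_bound_aux:
  fixes \<psi> :: "complex^('n::finite \<Rightarrow> 2)"
  assumes norm: "braket \<psi> \<psi> = 1"
    and le: "\<And>j::'n \<Rightarrow> 2 \<times> 2. (cmod (\<Sum>x\<in>UNIV. \<Sum>v\<in>UNIV. cnj (\<psi> $ x) * \<psi> $ v * (\<Prod>i\<in>UNIV. link same K i (j i) (x i) (v i))))\<^sup>2 + h j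
      \<le> (\<Sum>x\<in>UNIV. (cmod (\<psi> $ x))\<^sup>2 * env K (\<lambda>i. fst (j i)) x) * (\<Sum>v\<in>UNIV. (cmod (\<psi> $ v))\<^sup>2 * env K (\<lambda>i. snd (j i)) v)"
  shows "2 ^ card K * purity \<psi> K + (\<Sum>j\<in>UNIV. h j) \<le> 4 ^ card K"
proof -
  have "complex_of_real (\<Sum>x\<in>UNIV. (cmod (\<psi> $ x))\<^sup>2) = of_real 1"
    using norm by (simp only: braket_def of_real_sum complex_norm_square mult.commute of_real_1)
  then have one: "(\<Sum>x\<in>UNIV. (cmod (\<psi> $ x))\<^sup>2) = 1"
    by (simp only: of_real_eq_iff)
  have "2 ^ card K * purity \<psi> K + (\<Sum>j\<in>UNIV. h j) \<le>
    (\<Sum>j\<in>UNIV. (\<Sum>x\<in>UNIV. (cmod (\<psi> $ x))\<^sup>2 * env K (\<lambda>i. fst (j i)) x) * (\<Sum>v\<in>UNIV. (cmod (\<psi> $ v))\<^sup>2 * env K (\<lambda>i. snd (j i)) v))"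
    unfolding purity_link sum.distrib[symmetric] by (intro sum_mono le)
  also have "\<dots> = (\<Sum>x\<in>UNIV. \<Sum>v\<in>UNIV. (cmod (\<psi> $ x))\<^sup>2 * (cmod (\<psi> $ v))\<^sup>2 *
      (\<Sum>j\<in>UNIV. env K (\<lambda>i. fst (j i)) x * env K (\<lambda>i. snd (j i)) v))"
    unfolding sum_product
    by (subst sum.swap, rule sum.cong[OF refl], subst sum.swap) (simp add: sum_distrib_left mult_ac)
  also have "\<dots> = (\<Sum>x\<in>UNIV. (cmod (\<psi> $ x))\<^sup>2) * (\<Sum>v\<in>UNIV. (cmod (\<psi> $ v))\<^sup>2) * 4 ^ card K"
    unfolding sum_env_env sum_product by (simp only: sum_distrib_right)
  finally show ?thesis
    by (simp add: one)
qed

text \<open>Bessel's inequality for \<psi> restricted to \<open>s\<close>, against the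
  \<open>same\<close> image of \<psi> and the \<open>flip\<close> image of \<open>g\<close>. Both
  upper bounds follow from it, with \<open>g\<close> either zero or the conjugate of \<psi>.\<close>

lemma bessel_link:
  fixes \<psi> :: "complex^('n::finite \<Rightarrow> 2)" and j :: "'n \<Rightarrow> 2 \<times> 2"
  assumes orth: "(\<Sum>x\<in>UNIV. cnj (\<Sum>v\<in>UNIV. \<psi> $ v * (\<Prod>i\<in>UNIV. link same K i (j i) (x i) (v i))) *
      (\<Sum>u\<in>UNIV. g u * (\<Prod>i\<in>UNIV. link flip K i (j i) (x i) (u i)))) = 0"
    and le: "\<And>u. cmod (g u) \<le> cmod (\<psi> $ u)"
  shows "(cmod (\<Sum>x\<in>UNIV. \<Sum>v\<in>UNIV. cnj (\<psi> $ x) * \<psi> $ v * (\<Prod>i\<in>UNIV. link same K i (j i) (x i) (v i))))\<^sup>2 +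
      (cmod (\<Sum>x\<in>UNIV. \<Sum>u\<in>UNIV. cnj (\<psi> $ x) * g u * (\<Prod>i\<in>UNIV. link flip K i (j i) (x i) (u i))))\<^sup>2
      \<le> (\<Sum>x\<in>UNIV. (cmod (\<psi> $ x))\<^sup>2 * env K (\<lambda>i. fst (j i)) x) * (\<Sum>v\<in>UNIV. (cmod (\<psi> $ v))\<^sup>2 * env K (\<lambda>i. snd (j i)) v)"
proof -
  let ?a = "\<lambda>x. \<psi> $ x * of_real (env K (\<lambda>i. fst (j i)) x)"
  let ?l = "\<lambda>e f x. \<Sum>v\<in>UNIV. f v * (\<Prod>i\<in>UNIV. link e K i (j i) (x i) (v i))"
  have restrict: "(\<Sum>x\<in>UNIV. \<Sum>v\<in>UNIV. cnj (\<psi> $ x) * f v * (\<Prod>i\<in>UNIV. link e K i (j i) (x i) (v i))) =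
     (\<Sum>x\<in>UNIV. cnj (?a x) * ?l e f x)" for e f
    by (subst link_env[symmetric]) (simp add: sum_distrib_left mult_ac)
  have norm_a: "(\<Sum>x\<in>UNIV. (cmod (?a x))\<^sup>2) = (\<Sum>x\<in>UNIV. (cmod (\<psi> $ x))\<^sup>2 * env K (\<lambda>i. fst (j i)) x)"
    by (simp add: norm_mult power_mult_distrib env_square)
  have "(\<Sum>x\<in>UNIV. (cmod (?l flip g x))\<^sup>2) \<le> (\<Sum>x\<in>UNIV. (cmod (?l same (\<lambda>v. \<psi> $ v) x))\<^sup>2)"
    unfolding link_norm[OF flip_unitary] link_norm[OF same_unitary]
    by (intro sum_mono mult_right_mono power_mono le) (auto simp: env_def intro!: prod_nonneg)
  from bessel_two[OF orth this, of ?a] show ?thesis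
    unfolding restrict norm_a link_norm[OF same_unitary] .
qed

lemma purity_le:
  fixes \<psi> :: "complex^('n::finite \<Rightarrow> 2)"
  assumes "braket \<psi> \<psi> = 1"
  shows "purity \<psi> K \<le> 2 ^ card K"
proof -
  have "2 ^ card K * purity \<psi> K + (\<Sum>j\<in>(UNIV::('n \<Rightarrow> 2 \<times> 2) set). 0) \<le> 4 ^ card K"
  proof (rule purity_bound_aux[OF assms])
    fix j :: "'n \<Rightarrow> 2 \<times> 2"
    show "(cmod (\<Sum>x\<in>UNIV. \<Sum>v\<in>UNIV. cnj (\<psi> $ x) * \<psi> $ v * (\<Prod>i\<in>UNIV. link same K i (j i) (x i) (v i))))\<^sup>2 + 0
      \<le> (\<Sum>x\<in>UNIV. (cmod (\<psi> $ x))\<^sup>2 * env K (\<lambda>i. fst (j i)) x) * (\<Sum>v\<in>UNIV. (cmod (\<psi> $ v))\<^sup>2 * env K (\<lambda>i. snd (j i)) v)"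
      \<comment> \<open>With \<open>g = 0\<close> this is the Cauchy-Schwarz inequality.\<close>
      using bessel_link[of \<psi> K j "\<lambda>_. 0"] by simp
  qed
  also have "(4::real) ^ card K = 2 ^ card K * 2 ^ card K"
    by (simp flip: power_mult_distrib)
  finally show ?thesis
    by simp
qed

lemma purity_add_flip_overlap_le:
  fixes \<psi> :: "complex^('n::finite \<Rightarrow> 2)"
  assumes "braket \<psi> \<psi> = 1" and "odd (card K)"
  shows "purity \<psi> K + flip_overlap \<psi> K \<le> 2 ^ card K"
proof -
  have "2 ^ card K * purity \<psi> K + 2 ^ card K * flip_overlap \<psi> K \<le> 4 ^ card K"
    unfolding flip_overlap_link
    \<comment> \<open>Here \<open>g\<close> is the conjugate of \<psi>, so the second Bessel term is
      the summand of \<open>flip_overlap_link\<close>.\<close>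
    by (rule purity_bound_aux[OF assms(1)], rule bessel_link, rule link_same_flip_orthogonal[OF assms(2)]) simp
  also have "(4::real) ^ card K = 2 ^ card K * 2 ^ card K"
    by (simp flip: power_mult_distrib)
  finally show ?thesis
    by (simp flip: distrib_left)
qed

section \<open>From subsets to sector lengths\<close>

lemma card_supp: "card (supp \<mu>) = wt \<mu>"
  by (simp add: supp_def wt_def)

lemma wt_le: "wt (\<mu> :: 'n::finite \<Rightarrow> 4) \<le> CARD('n)"
  unfolding wt_def by (rule card_mono) auto

lemma card_Compl: "card (- A :: 'n::finite set) = CARD('n) - card A"
  by (simp add: Compl_eq_Diff_UNIV card_Diff_subset)

text \<open>Removing \<open>A\<close> leaves a free choice of the remaining elements in its
  complement.\<close>

lemma card_supersets:
  fixes A :: "'n::finite set"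
  assumes "card A \<le> k"
  shows "card {K. A \<subseteq> K \<and> card K = k} = (CARD('n) - card A) choose (k - card A)"
proof -
  have "bij_betw (\<lambda>K. K - A) {K. A \<subseteq> K \<and> card K = k} {B. B \<subseteq> - A \<and> card B = k - card A}"
  proof (rule bij_betw_byWitness[where f' = "\<lambda>B. B \<union> A"])
    show "(\<lambda>B. B \<union> A) ` {B. B \<subseteq> - A \<and> card B = k - card A} \<subseteq> {K. A \<subseteq> K \<and> card K = k}"
    proof clarsimp
      fix B assume "B \<subseteq> - A" and B: "card B = k - card A"
      then have "card (B \<union> A) = card B + card A"
        by (intro card_Un_disjoint) auto
      then show "card (B \<union> A) = k"
        using B assms by simp
    qed
  qed (auto simp: card_Diff_subset)
  then have "card {K. A \<subseteq> K \<and> card K = k} = card {B. B \<subseteq> - A \<and> card B = k - card A}"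
    by (rule bij_betw_same_card)
  also have "\<dots> = card (- A) choose (k - card A)"
    by (rule n_subsets) simp
  finally show ?thesis
    by (simp add: card_Compl)
qed

lemma card_subsets_card: "card {K :: 'n::finite set. card K = k} = CARD('n) choose k"
  using n_subsets[of "UNIV :: 'n set" k] by simp

lemma sector_length_ketbra:
  "sector_length (ketbra \<psi> \<psi>) m = (\<Sum>\<mu> | wt \<mu> = m. (expval \<psi> \<mu>)\<^sup>2)"
  by (simp add: sector_length_def expval_def)

lemma sector_length_nonneg: "0 \<le> sector_length \<rho> m"
  unfolding sector_length_def by (rule sum_nonneg) simp

lemma sum_sector_length:
  fixes \<psi> :: "complex^('n::finite \<Rightarrow> 2)"
  shows "(\<Sum>\<mu>\<in>UNIV. g (wt \<mu>) * (expval \<psi> \<mu>)\<^sup>2) = (\<Sum>m=0..CARD('n). g m * sector_length (ketbra \<psi> \<psi>) m)"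
proof -
  have "(\<Sum>\<mu>\<in>UNIV. g (wt \<mu>) * (expval \<psi> \<mu>)\<^sup>2) =
      (\<Sum>m=0..CARD('n). \<Sum>\<mu> | \<mu> \<in> UNIV \<and> wt \<mu> = m. g (wt \<mu>) * (expval \<psi> \<mu>)\<^sup>2)"
    by (rule sum.group[symmetric]) (auto simp: wt_le)
  also have "\<dots> = (\<Sum>m=0..CARD('n). g m * sector_length (ketbra \<psi> \<psi>) m)"
    by (simp add: sector_length_ketbra sum_distrib_left)
  finally show ?thesis .
qed

text \<open>Double counting: a Pauli string occurs once for every \<open>k\<close>-element set that
  contains its support, and the number of these sets depends only on its weight.\<close>

lemma sum_subsets_sector_length:
  fixes \<psi> :: "complex^('n::finite \<Rightarrow> 2)"
  assumes k: "k \<le> CARD('n)"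
  shows "(\<Sum>K | card K = k. \<Sum>\<mu> | supp \<mu> \<subseteq> K. g (wt \<mu>) * (expval \<psi> \<mu>)\<^sup>2) =
    (\<Sum>m=0..k. g m * real ((CARD('n) - m) choose (k - m)) * sector_length (ketbra \<psi> \<psi>) m)"
proof -
  have "(\<Sum>K | card K = k. \<Sum>\<mu> | supp \<mu> \<subseteq> K. g (wt \<mu>) * (expval \<psi> \<mu>)\<^sup>2) =
    (\<Sum>\<mu>\<in>UNIV. real (card {K. supp \<mu> \<subseteq> K \<and> card K = k}) * (g (wt \<mu>) * (expval \<psi> \<mu>)\<^sup>2))"
  proof -
    have "(\<Sum>K | card K = k. \<Sum>\<mu> | supp \<mu> \<subseteq> K. g (wt \<mu>) * (expval \<psi> \<mu>)\<^sup>2) =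
      (\<Sum>\<mu>\<in>UNIV. \<Sum>K\<in>UNIV. of_bool (supp \<mu> \<subseteq> K \<and> card K = k) * (g (wt \<mu>) * (expval \<psi> \<mu>)\<^sup>2))"
      unfolding sum_Collect_of_bool sum_distrib_left
      by (subst sum.swap) (simp only: of_bool_conj mult_ac)
    then show ?thesis
      by (simp add: sum_Collect_of_bool[symmetric])
  qed
  \<comment> \<open>The case distinction is essential: for \<open>wt \<mu> > k\<close> truncated
    subtraction would make the binomial coefficient 1 instead of 0.\<close>
  also have "\<dots> = (\<Sum>\<mu>\<in>UNIV. (if wt \<mu> \<le> k then g (wt \<mu>) * real ((CARD('n) - wt \<mu>) choose (k - wt \<mu>)) else 0) * (expval \<psi> \<mu>)\<^sup>2)"
  proof (rule sum.cong[OF refl])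
    fix \<mu> :: "'n \<Rightarrow> 4"
    show "real (card {K. supp \<mu> \<subseteq> K \<and> card K = k}) * (g (wt \<mu>) * (expval \<psi> \<mu>)\<^sup>2) =
      (if wt \<mu> \<le> k then g (wt \<mu>) * real ((CARD('n) - wt \<mu>) choose (k - wt \<mu>)) else 0) * (expval \<psi> \<mu>)\<^sup>2"
    proof (cases "wt \<mu> \<le> k")
      case True
      then show ?thesis
        using card_supersets[of "supp \<mu>" k] by (simp add: card_supp)
    next
      case False
      then have "{K. supp \<mu> \<subseteq> K \<and> card K = k} = {}"
        using card_mono[OF finite, of "supp \<mu>"] by (auto simp: card_supp)
      then show ?thesis
        using False by simp
    qed
  qed
  also have "\<dots> = (\<Sum>m=0..CARD('n). (if m \<le> k then g m * real ((CARD('n) - m) choose (k - m)) else 0) * sector_length (ketbra \<psi> \<psi>) m)"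
    by (rule sum_sector_length)
  also have "\<dots> = (\<Sum>m=0..k. g m * real ((CARD('n) - m) choose (k - m)) * sector_length (ketbra \<psi> \<psi>) m)"
    using k by (intro sum.mono_neutral_cong_right) auto
  finally show ?thesis .
qed

lemma sum_purity:
  fixes \<psi> :: "complex^('n::finite \<Rightarrow> 2)"
  assumes "k \<le> CARD('n)"
  shows "(\<Sum>m=0..k. real ((CARD('n) - m) choose (k - m)) * sector_length (ketbra \<psi> \<psi>) m) = (\<Sum>K | card K = k. purity \<psi> K)"
  using sum_subsets_sector_length[OF assms, of "\<lambda>_. 1" \<psi>] by (simp add: purity_def)

lemma sum_flip_overlap:
  fixes \<psi> :: "complex^('n::finite \<Rightarrow> 2)"
  assumes "k \<le> CARD('n)"
  shows "(\<Sum>m=0..k. (-1) ^ m * real ((CARD('n) - m) choose (k - m)) * sector_length (ketbra \<psi> \<psi>) m) = (\<Sum>K | card K = k. flip_overlap \<psi> K)"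
  using sum_subsets_sector_length[OF assms, of "\<lambda>m. (-1) ^ m" \<psi>] by (simp add: flip_overlap_def)

lemma flip_overlap_le_purity: "flip_overlap \<psi> K \<le> purity \<psi> K"
  unfolding flip_overlap_def purity_def
proof (rule sum_mono)
  show "(-1) ^ wt \<mu> * (expval \<psi> \<mu>)\<^sup>2 \<le> (expval \<psi> \<mu>)\<^sup>2" for \<mu>
    by (cases "even (wt \<mu>)") auto
qed

section \<open>Lower bounds on purities\<close>

lemma expval_zero:
  fixes \<psi> :: "complex^('n::finite \<Rightarrow> 2)"
  assumes "braket \<psi> \<psi> = 1"
  shows "expval \<psi> (\<lambda>_. 0) = 1"
proof -
  have "complex_of_real (expval \<psi> (\<lambda>_. 0)) = (\<Sum>x\<in>UNIV. \<Sum>y\<in>UNIV. if x = y then cnj (\<psi> $ x) * \<psi> $ x else 0)"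
  proof -
    have "(\<Prod>i\<in>UNIV. of_bool (x i = y i)) = (of_bool (x = y) :: complex)" for x y :: "'n \<Rightarrow> 2"
      by (simp add: prod_of_bool fun_eq_iff)
    then show ?thesis
      unfolding of_real_expval pauli_entries by (intro sum.cong refl) auto
  qed
  also have "\<dots> = 1"
    using assms by (simp add: braket_def)
  finally show ?thesis
    by simp
qed

lemma purity_empty:
  assumes "braket \<psi> \<psi> = 1"
  shows "purity \<psi> {} = 1"
proof -
  have "{\<mu>. supp \<mu> \<subseteq> {}} = {\<lambda>_::'a. 0}"
    by (auto simp: supp_def)
  then show ?thesis
    by (simp add: purity_def expval_zero[OF assms])
qed

lemma purity_mono: "K \<subseteq> L \<Longrightarrow> purity \<psi> K \<le> purity \<psi> L"
  unfolding purity_def by (rule sum_mono2) auto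

lemma purity_ge_one: "braket \<psi> \<psi> = 1 \<Longrightarrow> 1 \<le> purity \<psi> K"
  using purity_mono[of "{}" K \<psi>] by (simp add: purity_empty)

text \<open>The identity string alone contributes 1. If \<open>K\<close> has more than half of the
  qubits, the same bound on its complement is stronger and is transferred by
  \<open>purity_compl\<close>.\<close>

lemma purity_ge:
  fixes \<psi> :: "complex^('n::finite \<Rightarrow> 2)"
  assumes "braket \<psi> \<psi> = 1"
  shows "2 ^ card K / 2 ^ min (card K) (CARD('n) - card K) \<le> purity \<psi> K"
proof (cases "card K \<le> CARD('n) - card K")
  case True
  then show ?thesis
    using purity_ge_one[OF assms, of K] by simp
next
  case False
  have "2 ^ card K / 2 ^ card (- K) * 1 \<le> 2 ^ card K / 2 ^ card (- K) * purity \<psi> (- K)"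
    by (intro mult_left_mono purity_ge_one assms) simp
  also have "\<dots> = purity \<psi> K"
    using purity_compl[of \<psi> K] by (simp add: field_simps)
  finally show ?thesis
    using False by (simp add: card_Compl)
qed

lemma purity_UNIV:
  fixes \<psi> :: "complex^('n::finite \<Rightarrow> 2)"
  shows "braket \<psi> \<psi> = 1 \<Longrightarrow> purity \<psi> UNIV = 2 ^ CARD('n)"
  using purity_compl[of \<psi> UNIV] by (simp add: purity_empty)

section \<open>Kravchuk polynomials as sums of commutation signs\<close>

lemma prod_monom:
  "finite A \<Longrightarrow> (\<Prod>i\<in>A. monom (a i) (k i)) = monom (\<Prod>i\<in>A. a i :: 'a::comm_semiring_1) (\<Sum>i\<in>A. k i)"
  by (induction A rule: finite_induct) (auto simp: mult_monom one_pCons)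

lemma coeff_one_linear_power: "coeff ([:1, c::real:] ^ n) i = real (n choose i) * c ^ i"
proof (cases "i \<le> n")
  case False
  have "degree ([:1, c:] ^ n) \<le> degree [:1, c:] * n"
    by (rule degree_power_le)
  also have "\<dots> \<le> 1 * n"
    by (intro mult_right_mono) auto
  finally show ?thesis
    using False by (simp add: coeff_eq_0)
qed (simp add: coeff_linear_poly_power)

text \<open>Both sides are the coefficient of \<open>z\<^sup>g\<close> in \<open>(1 - z)\<^sup>m (1 + 3 z)\<^bsup>N - m\<^esup>\<close>, where \<open>m = wt \<mu>\<close>.\<close>

lemma kravchuk_eq_sum_chi:
  fixes \<mu> :: "'n::finite \<Rightarrow> 4"
  shows "kravchuk g (wt \<mu>) CARD('n) = (\<Sum>\<nu> | wt \<nu> = g. \<Prod>i\<in>UNIV. chi (\<mu> i) (\<nu> i))"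
proof -
  let ?p = "\<lambda>\<nu>. monom (\<Prod>i\<in>UNIV. chi (\<mu> i) (\<nu> i)) (wt \<nu>)"
  have "(\<Sum>\<nu>\<in>UNIV. ?p \<nu>) = (\<Sum>\<nu>\<in>UNIV. \<Prod>i\<in>UNIV. monom (chi (\<mu> i) (\<nu> i)) (of_bool (\<nu> i \<noteq> 0)))"
  proof -
    have "wt \<nu> = (\<Sum>i\<in>UNIV. of_bool (\<nu> i \<noteq> 0))" for \<nu> :: "'n \<Rightarrow> 4"
      by (simp add: wt_def)
    then show ?thesis
      by (simp only: prod_monom finite)
  qed
  also have "\<dots> = (\<Prod>i\<in>UNIV. \<Sum>b\<in>UNIV. monom (chi (\<mu> i) b) (of_bool (b \<noteq> 0)))"
    by (rule prod_sum_fun)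
  \<comment> \<open>Among the three nontrivial Pauli matrices all commute with the identity, while
    one commutes and two anticommute with a given nontrivial one. The linear coefficients are thus 3
    and \<open>1 - 2 = -1\<close>.\<close>
  also have "\<dots> = (\<Prod>i\<in>UNIV. (if i \<in> supp \<mu> then [:1, -1:] else 1) * (if i \<in> - supp \<mu> then [:1, 3:] else 1))"
  proof (rule prod.cong[OF refl])
    fix i
    show "(\<Sum>b\<in>UNIV. monom (chi (\<mu> i) b) (of_bool (b \<noteq> 0))) =
      (if i \<in> supp \<mu> then [:1, -1:] else 1) * (if i \<in> - supp \<mu> then [:1, 3:] else 1)"
      using pauli_index_cases[of "\<mu> i"]
      by (auto simp: pauli_index_sum chi_def supp_def monom_Suc monom_0)
  qed
  also have "\<dots> = [:1, -1:] ^ wt \<mu> * [:1, 3:] ^ (CARD('n) - wt \<mu>)"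
    unfolding prod.distrib prod_if_const by (simp add: card_supp card_Compl)
  finally have "coeff (\<Sum>\<nu>\<in>UNIV. ?p \<nu>) g = coeff ([:1, -1:] ^ wt \<mu> * [:1, 3:] ^ (CARD('n) - wt \<mu>)) g"
    by simp
  also have "\<dots> = kravchuk g (wt \<mu>) CARD('n)"
    unfolding coeff_mult coeff_one_linear_power kravchuk_def
    by (simp add: atLeast0AtMost mult_ac)
  also have "coeff (\<Sum>\<nu>\<in>UNIV. ?p \<nu>) g = (\<Sum>\<nu> | wt \<nu> = g. \<Prod>i\<in>UNIV. chi (\<mu> i) (\<nu> i))"
    unfolding coeff_sum by (rule sum.mono_neutral_cong_right) auto
  finally show ?thesis
    by simp
qed

text \<open>Summing the shadow inequality over all \<nu> of weight \<open>g\<close> leaves signs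
  that depend on \<mu> only through its weight.\<close>

lemma kravchuk_sector_length_nonneg:
  fixes \<psi> :: "complex^('n::finite \<Rightarrow> 2)"
  shows "0 \<le> (\<Sum>m=0..CARD('n). (-1) ^ m * kravchuk g m CARD('n) * sector_length (ketbra \<psi> \<psi>) m)"
proof -
  have "(\<Sum>m=0..CARD('n). (-1) ^ m * kravchuk g m CARD('n) * sector_length (ketbra \<psi> \<psi>) m) =
    (\<Sum>\<mu>\<in>UNIV. (-1) ^ wt \<mu> * kravchuk g (wt \<mu>) CARD('n) * (expval \<psi> \<mu>)\<^sup>2)"
    by (rule sum_sector_length[symmetric])
  also have "\<dots> = (\<Sum>\<nu> | wt \<nu> = g. \<Sum>\<mu>\<in>UNIV. (-1) ^ wt \<mu> * (\<Prod>i\<in>UNIV. chi (\<mu> i) (\<nu> i)) * (expval \<psi> \<mu>)\<^sup>2)"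
    unfolding kravchuk_eq_sum_chi
    by (subst sum.swap) (simp add: sum_distrib_left sum_distrib_right)
  also have "\<dots> \<ge> 0"
    by (rule sum_nonneg) (rule shadow_nonneg)
  finally show ?thesis .
qed

lemma sector_length_zero:
  assumes "braket \<psi> \<psi> = 1"
  shows "sector_length (ketbra \<psi> \<psi>) 0 = 1"
proof -
  have "{\<mu>. wt \<mu> = 0} = {\<mu> :: 'a \<Rightarrow> 4. supp \<mu> \<subseteq> {}}"
    by (auto simp: wt_def supp_def)
  then show ?thesis
    using purity_empty[OF assms] by (simp add: sector_length_ketbra purity_def)
qed

text \<open>At \<open>m = 0\<close> the convention built into \<open>coord\<close> agrees with the
  true sector length because \<psi> is normalised.\<close>

lemma coord_sector_vector:
  fixes \<psi> :: "complex^('n::{finite,linorder} \<Rightarrow> 2)"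
  assumes "braket \<psi> \<psi> = 1" and "m \<le> CARD('n)"
  shows "coord (sector_vector (ketbra \<psi> \<psi>)) m = sector_length (ketbra \<psi> \<psi>) m"
proof (cases "m = 0")
  case True
  then show ?thesis
    using sector_length_zero[OF assms(1)] by (simp add: coord_def)
next
  case False
  then obtain i :: 'n where "position i = m"
    using bij_betw_position[where 'n = 'n] assms(2) by (auto simp: bij_betw_def image_iff set_eq_iff)
      (metis One_nat_def Suc_leI atLeastAtMost_iff neq0_conv)
  then show ?thesis
    using coord_position[of "sector_vector (ketbra \<psi> \<psi>)" i] by (simp add: sector_vector_def)
qed

text \<open>Averaging the plain and the alternating sum keeps exactly the even terms up to
  \<open>k\<close>. For even \<open>k\<close> the left side stops at \<open>k - 2\<close> and omits
  the last of them.\<close>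

lemma even_sum_le:
  fixes h :: "nat \<Rightarrow> real"
  assumes "\<And>m. 0 \<le> h m" and "1 \<le> k"
  shows "(\<Sum>m=0..(k - 1) div 2. h (2 * m)) \<le> ((\<Sum>m=0..k. h m) + (\<Sum>m=0..k. (-1) ^ m * h m)) / 2"
proof -
  have "(\<Sum>m=0..(k - 1) div 2. h (2 * m)) = (\<Sum>m\<in>(*) 2 ` {0..(k - 1) div 2}. h m)"
    by (simp add: sum.reindex inj_on_def)
  also have "\<dots> \<le> (\<Sum>m | m \<in> {0..k} \<and> even m. h m)"
    using assms by (intro sum_mono2) auto
  also have "\<dots> = (\<Sum>m=0..k. (h m + (-1) ^ m * h m) / 2)"
    by (rule sum.mono_neutral_cong_left) auto
  finally show ?thesis
    by (simp add: sum.distrib flip: sum_divide_distrib)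
qed

section \<open>The linear inequalities\<close>

lemma pure_sector_vector_in_R1:
  fixes \<psi> :: "complex^('n::{finite,linorder} \<Rightarrow> 2)"
  assumes \<psi>: "braket \<psi> \<psi> = 1"
  shows "sector_vector (ketbra \<psi> \<psi>) \<in> R1"
proof -
  let ?N = "CARD('n)"
  define s where "s = sector_length (ketbra \<psi> \<psi>)"
  define c where "c = coord (sector_vector (ketbra \<psi> \<psi>))"
  have c_sum: "(\<Sum>m=0..k. h m * c m) = (\<Sum>m=0..k. h m * s m)" if "k \<le> ?N" for h k
    using that coord_sector_vector[OF \<psi>] by (intro sum.cong refl) (simp add: s_def c_def)
  have "K = UNIV" if "card K = ?N" for K :: "'n set"
    by (rule card_subset_eq) (use that in simp_all)
  then have all: "{K :: 'n set. card K = ?N} = {UNIV}"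
    by blast
  have total: "(\<Sum>m=0..?N. c m) = 2 ^ ?N"
    using sum_purity[of ?N \<psi>] c_sum[of ?N "\<lambda>_. 1"] purity_UNIV[OF \<psi>]
    by (simp add: all s_def)
  have alt: "(\<Sum>m=0..?N. (-1) ^ m * c m) = flip_overlap \<psi> UNIV"
    using sum_flip_overlap[of ?N \<psi>] c_sum[of ?N "\<lambda>m. (-1) ^ m"]
    by (simp add: all s_def)
  have alt_le: "flip_overlap \<psi> UNIV \<le> 2 ^ ?N"
    using flip_overlap_le_purity[of \<psi> UNIV] purity_UNIV[OF \<psi>] by simp
  \<comment> \<open>The purity of the whole state already exhausts the odd-case bound on the sum of
    purity and flip overlap, so nothing remains for the latter.\<close>
  have alt_odd: "flip_overlap \<psi> UNIV = 0" if "odd ?N"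
    using purity_add_flip_overlap_le[OF \<psi>, of UNIV] purity_UNIV[OF \<psi>] flip_overlap_nonneg[of \<psi> UNIV] that
    by simp
  \<comment> \<open>Both sides are sums of marginal purities, over sets of size \<open>N - k\<close>
    and of size \<open>k\<close>; complementation matches them. The binomial coefficients only have
    to be reflected.\<close>
  have dual: "1 / 2 ^ (?N - k) * (\<Sum>m=0..?N - k. real ((?N - m) choose k) * c m) =
      1 / 2 ^ k * (\<Sum>m=0..k. real ((?N - m) choose (?N - k)) * c m)" if k: "k \<le> ?N" for k
  proof -
    have "(\<Sum>m=0..?N - k. real ((?N - m) choose k) * c m) = (\<Sum>m=0..?N - k. real ((?N - m) choose (?N - k - m)) * s m)"
    proof (subst c_sum)
      show "(\<Sum>m=0..?N - k. real ((?N - m) choose k) * s m) = (\<Sum>m=0..?N - k. real ((?N - m) choose (?N - k - m)) * s m)"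
      proof (rule sum.cong[OF refl])
        fix m assume "m \<in> {0..?N - k}"
        then have "k \<le> ?N - m" "?N - m - k = ?N - k - m"
          using k by auto
        then show "real ((?N - m) choose k) * s m = real ((?N - m) choose (?N - k - m)) * s m"
          using binomial_symmetric[of k "?N - m"] by simp
      qed
    qed simp
    also have "\<dots> = (\<Sum>K | card K = ?N - k. purity \<psi> K)"
      unfolding s_def by (rule sum_purity) simp
    also have "1 / 2 ^ (?N - k) * \<dots> = (\<Sum>K | card K = ?N - k. purity \<psi> K / 2 ^ card K)"
      by (simp add: sum_distrib_left)
    also have "\<dots> = (\<Sum>K | card K = ?N - k. purity \<psi> (- K) / 2 ^ card (- K))"
      by (intro sum.cong refl purity_compl)
    also have "\<dots> = (\<Sum>K | card K = k. purity \<psi> K / 2 ^ card K)"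
      by (rule sum.reindex_bij_witness[of _ uminus uminus]) (use k in \<open>auto simp: card_Compl\<close>)
    also have "\<dots> = 1 / 2 ^ k * (\<Sum>K | card K = k. purity \<psi> K)"
      by (simp add: sum_distrib_left)
    also have "(\<Sum>K | card K = k. purity \<psi> K) = (\<Sum>m=0..k. real ((?N - m) choose (k - m)) * s m)"
      unfolding s_def by (rule sum_purity[symmetric]) (rule k)
    also have "\<dots> = (\<Sum>m=0..k. real ((?N - m) choose (?N - k)) * c m)"
    proof (subst c_sum)
      show "(\<Sum>m=0..k. real ((?N - m) choose (k - m)) * s m) = (\<Sum>m=0..k. real ((?N - m) choose (?N - k)) * s m)"
      proof (rule sum.cong[OF refl])
        fix m assume "m \<in> {0..k}"
        then have "k - m \<le> ?N - m" "?N - m - (k - m) = ?N - k"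
          using k by auto
        then show "real ((?N - m) choose (k - m)) * s m = real ((?N - m) choose (?N - k)) * s m"
          using binomial_symmetric[of "k - m" "?N - m"] by simp
      qed
    qed (use k in simp_all)
    finally show ?thesis .
  qed
  have "\<forall>i. 0 \<le> sector_vector (ketbra \<psi> \<psi>) $ i"
    by (simp add: sector_vector_def sector_length_nonneg)
  then show ?thesis
    unfolding R1_def Let_def mem_Collect_eq c_def[symmetric] total alt
    using alt_le alt_odd dual flip_overlap_nonneg[of \<psi> UNIV] by simp
qed

lemma pure_sector_vector_in_R2:
  fixes \<psi> :: "complex^('n::{finite,linorder} \<Rightarrow> 2)"
  assumes \<psi>: "braket \<psi> \<psi> = 1"
  shows "sector_vector (ketbra \<psi> \<psi>) \<in> R2"
proof -
  have "0 \<le> (\<Sum>m=0..CARD('n). (-1) ^ m * kravchuk g m CARD('n) * coord (sector_vector (ketbra \<psi> \<psi>)) m)" for g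
    using kravchuk_sector_length_nonneg[of g \<psi>] by (simp add: coord_sector_vector[OF \<psi>])
  then show ?thesis
    using pure_sector_vector_in_R1[OF \<psi>] by (simp add: R2_def)
qed

lemma pure_sector_vector_in_R3:
  fixes \<psi> :: "complex^('n::{finite,linorder} \<Rightarrow> 2)"
  assumes \<psi>: "braket \<psi> \<psi> = 1"
  shows "sector_vector (ketbra \<psi> \<psi>) \<in> R3"
proof -
  let ?N = "CARD('n)"
  define s where "s = sector_length (ketbra \<psi> \<psi>)"
  define c where "c = coord (sector_vector (ketbra \<psi> \<psi>))"
  have c: "c m = s m" if "m \<le> ?N" for m
    using coord_sector_vector[OF \<psi> that] by (simp add: s_def c_def)
  have bounds: "2 ^ k / 2 ^ min k (?N - k) * real (?N choose k)
        \<le> (\<Sum>m=0..k. real ((?N - m) choose (k - m)) * c m) \<and>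
      (\<Sum>m=0..k. real ((?N - m) choose (k - m)) * c m) \<le> 2 ^ k * real (?N choose k) \<and>
      0 \<le> (\<Sum>m=0..k. (-1) ^ m * real ((?N - m) choose (k - m)) * c m) \<and>
      (\<Sum>m=0..k. (-1) ^ m * real ((?N - m) choose (k - m)) * c m) \<le> 2 ^ k * real (?N choose k) \<and>
      (\<Sum>m=0..(k - 1) div 2. real ((?N - 2 * m) choose (k - 2 * m)) * c (2 * m))
        \<le> 2 powi (int k - 2) * (3 + (-1) ^ k) * real (?N choose k)"
    if k: "1 \<le> k" "k \<le> ?N" for k
  proof -
    \<comment> \<open>All the bounds are sums over the sets \<open>K\<close> of bounds on single
      marginals. The even-index sum is controlled by \<open>(P + F) / 2\<close>.\<close>
    define P where "P = (\<Sum>K | card K = k. purity \<psi> K)"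
    define F where "F = (\<Sum>K | card K = k. flip_overlap \<psi> K)"
    have const: "(\<Sum>K :: 'n set | card K = k. a) = a * real (?N choose k)" for a
      by (simp add: card_subsets_card)
    have P: "(\<Sum>m=0..k. real ((?N - m) choose (k - m)) * c m) = P"
      using sum_purity[OF k(2), of \<psi>] k(2) by (simp add: P_def c s_def)
    have F: "(\<Sum>m=0..k. (-1) ^ m * real ((?N - m) choose (k - m)) * c m) = F"
      using sum_flip_overlap[OF k(2), of \<psi>] k(2) by (simp add: F_def c s_def)
    have P_ge: "2 ^ k / 2 ^ min k (?N - k) * real (?N choose k) \<le> P"
      unfolding P_def const[symmetric] using purity_ge[OF \<psi>] by (intro sum_mono) auto
    have P_le: "P \<le> 2 ^ k * real (?N choose k)"
      unfolding P_def const[symmetric] using purity_le[OF \<psi>] by (intro sum_mono) auto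
    have F_ge: "0 \<le> F"
      unfolding F_def by (intro sum_nonneg flip_overlap_nonneg)
    have F_le: "F \<le> P"
      unfolding F_def P_def by (intro sum_mono flip_overlap_le_purity)
    have odd_le: "P + F \<le> 2 ^ k * real (?N choose k)" if "odd k"
      unfolding P_def F_def const[symmetric] sum.distrib[symmetric]
      using purity_add_flip_overlap_le[OF \<psi>] that by (intro sum_mono) auto
    have "(\<Sum>m=0..(k - 1) div 2. real ((?N - 2 * m) choose (k - 2 * m)) * c (2 * m)) =
      (\<Sum>m=0..(k - 1) div 2. real ((?N - 2 * m) choose (k - 2 * m)) * s (2 * m))"
      using k by (intro sum.cong refl) (auto simp: c)
    also have "\<dots> \<le> ((\<Sum>m=0..k. real ((?N - m) choose (k - m)) * s m) +
        (\<Sum>m=0..k. (-1) ^ m * (real ((?N - m) choose (k - m)) * s m))) / 2"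
      by (rule even_sum_le[where h = "\<lambda>m. real ((?N - m) choose (k - m)) * s m"])
        (use k in \<open>simp_all add: s_def sector_length_nonneg\<close>)
    also have "\<dots> = (P + F) / 2"
      using P F k(2) by (simp add: c mult.assoc)
    \<comment> \<open>The right-hand coefficient is \<open>2 ^ k\<close> for even \<open>k\<close>,
      where \<open>F \<le> P\<close> suffices, and half of that for odd \<open>k\<close>, where the
      joint bound on \<open>P + F\<close> is needed.\<close>
    also have "\<dots> \<le> 2 powi (int k - 2) * (3 + (-1) ^ k) * real (?N choose k)"
    proof -
      have powi: "(2::real) powi (int k - 2) = 2 ^ k / 4"
        by (simp add: power_int_diff)
      show ?thesis
        unfolding powi using odd_le P_le F_le by (cases "even k") auto
    qed
    finally show ?thesis
      unfolding P F using P_ge P_le F_ge F_le by linarith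
  qed
  have "sector_vector (ketbra \<psi> \<psi>) \<in> R1"
    by (rule pure_sector_vector_in_R1[OF \<psi>])
  then show ?thesis
    unfolding R3_def Let_def mem_Collect_eq c_def[symmetric] using bounds by simp
qed

section \<open>Polyhedra and boundedness\<close>

text \<open>Affine and not linear, because \<open>coord S 0\<close> is the constant 1.\<close>

definition affine_functional :: "('a::real_inner \<Rightarrow> real) \<Rightarrow> bool" where
  "affine_functional f \<longleftrightarrow> (\<exists>a b. \<forall>x. f x = a \<bullet> x + b)"

lemma affine_functional_const: "affine_functional (\<lambda>x. c)"
  unfolding affine_functional_def by (intro exI[of _ 0] exI[of _ c]) simp

lemma affine_functional_add:
  "affine_functional f \<Longrightarrow> affine_functional g \<Longrightarrow> affine_functional (\<lambda>x. f x + g x)"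
  unfolding affine_functional_def
proof (elim exE)
  fix a b a' b' assume "\<forall>x. f x = a \<bullet> x + b" "\<forall>x. g x = a' \<bullet> x + b'"
  then show "\<exists>a b. \<forall>x. f x + g x = a \<bullet> x + b"
    by (intro exI[of _ "a + a'"] exI[of _ "b + b'"]) (simp add: inner_add_left)
qed

lemma affine_functional_cmult:
  "affine_functional f \<Longrightarrow> affine_functional (\<lambda>x. c * f x)"
  unfolding affine_functional_def
proof (elim exE)
  fix a b assume "\<forall>x. f x = a \<bullet> x + b"
  then show "\<exists>a b. \<forall>x. c * f x = a \<bullet> x + b"
    by (intro exI[of _ "c *\<^sub>R a"] exI[of _ "c * b"]) (simp add: algebra_simps)
qed

lemma affine_functional_sum:
  "(\<And>i. i \<in> I \<Longrightarrow> affine_functional (f i)) \<Longrightarrow> affine_functional (\<lambda>x. \<Sum>i\<in>I. f i x)"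
  by (induction I rule: infinite_finite_induct) (auto intro: affine_functional_const affine_functional_add)

lemma affine_functional_nth: "affine_functional (\<lambda>x :: real^'n::finite. x $ i)"
  unfolding affine_functional_def
  by (intro exI[of _ "axis i 1"] exI[of _ 0]) (simp add: inner_axis' )

lemma affine_functional_coord: "affine_functional (\<lambda>S. coord S m)"
  by (cases "m = 0") (simp_all add: coord_def affine_functional_const affine_functional_nth)

lemma polyhedron_affine_le:
  fixes f g :: "'a::euclidean_space \<Rightarrow> real"
  assumes "affine_functional f" and "affine_functional g"
  shows "polyhedron {x. f x \<le> g x}"
proof -
  obtain a b where f: "\<And>x. f x = a \<bullet> x + b"
    using assms(1) by (auto simp: affine_functional_def)
  obtain a' b' where g: "\<And>x. g x = a' \<bullet> x + b'"
    using assms(2) by (auto simp: affine_functional_def)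
  have "{x. f x \<le> g x} = {x. (a - a') \<bullet> x \<le> b' - b}"
    by (auto simp: f g algebra_simps)
  then show ?thesis
    by (simp add: polyhedron_halfspace_le)
qed

lemma polyhedron_conj:
  "polyhedron {x. P x} \<Longrightarrow> polyhedron {x. Q x} \<Longrightarrow> polyhedron {x. P x \<and> Q x}"
  by (simp add: Collect_conj_eq)

lemma polyhedron_affine_eq:
  fixes f g :: "'a::euclidean_space \<Rightarrow> real"
  assumes "affine_functional f" and "affine_functional g"
  shows "polyhedron {x. f x = g x}"
  unfolding order_eq_iff[of "f _"] by (intro polyhedron_conj polyhedron_affine_le assms)

lemma polyhedron_ball:
  assumes "finite A" and "\<And>k. k \<in> A \<Longrightarrow> polyhedron {x. P k x}"
  shows "polyhedron {x :: 'a::euclidean_space. \<forall>k\<in>A. P k x}"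
proof -
  have "{x. \<forall>k\<in>A. P k x} = \<Inter> ((\<lambda>k. {x. P k x}) ` A)"
    by auto
  then show ?thesis
    using assms by auto
qed

lemma polyhedron_all_finite:
  assumes "\<And>i::'i::finite. polyhedron {x. P i x}"
  shows "polyhedron {x :: 'a::euclidean_space. \<forall>i. P i x}"
  using polyhedron_ball[of UNIV P] assms by simp

lemmas affine_functional_intros =
  affine_functional_const affine_functional_cmult affine_functional_sum
  affine_functional_nth affine_functional_coord

text \<open>The condition is the parity of \<open>N\<close>, the same for all points.\<close>

lemma polyhedron_if:
  "polyhedron {x. P x} \<Longrightarrow> polyhedron {x. Q x} \<Longrightarrow> polyhedron {x. if b then P x else Q x}"
  by (cases b) simp_all

lemma polyhedron_R1: "polyhedron (R1 :: (real^'n::{finite,linorder}) set)"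
  unfolding R1_def Let_def
  by (intro polyhedron_conj polyhedron_if polyhedron_all_finite polyhedron_ball finite_atLeastAtMost
      polyhedron_affine_le polyhedron_affine_eq; intro affine_functional_intros)

lemma polyhedron_R2: "polyhedron (R2 :: (real^'n::{finite,linorder}) set)"
proof -
  have "polyhedron {S :: real^'n::{finite,linorder}. S \<in> R1}"
    by (simp add: polyhedron_R1)
  then show ?thesis
    unfolding R2_def Let_def
    by (rule polyhedron_conj)
      (intro polyhedron_ball finite_atLeastAtMost polyhedron_affine_le; intro affine_functional_intros)
qed

lemma polyhedron_R3: "polyhedron (R3 :: (real^'n::{finite,linorder}) set)"
proof -
  have "polyhedron {S :: real^'n::{finite,linorder}. S \<in> R1}"
    by (simp add: polyhedron_R1)
  then show ?thesis
    unfolding R3_def Let_def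
    by (rule polyhedron_conj)
      (intro polyhedron_conj polyhedron_ball finite_atLeastAtMost polyhedron_affine_le; intro affine_functional_intros)
qed

text \<open>Nonnegative components whose sum, together with the constant 1, is \<open>2 ^ N\<close>
  all lie between 0 and \<open>2 ^ N\<close>.\<close>

lemma bounded_R1: "bounded (R1 :: (real^'n::{finite,linorder}) set)"
proof (rule bounded_subset[OF bounded_cbox])
  show "(R1 :: (real^'n::{finite,linorder}) set) \<subseteq> cbox 0 (\<chi> i. 2 ^ CARD('n))"
  proof
    fix S :: "real^'n::{finite,linorder}" assume S: "S \<in> R1"
    have nonneg: "0 \<le> S $ i" for i
      using S by (simp add: R1_def Let_def)
    then have coord_nonneg: "0 \<le> coord S m" for m
      by (simp add: coord_def)
    have "S $ i \<le> 2 ^ CARD('n)" for i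
    proof -
      have "position i \<in> {0..CARD('n)}"
        unfolding position_def by (auto intro: card_mono)
      then have "coord S (position i) \<le> (\<Sum>m=0..CARD('n). coord S m)"
        by (intro member_le_sum coord_nonneg) auto
      then show ?thesis
        using S by (simp add: R1_def Let_def)
    qed
    then show "S \<in> cbox 0 (\<chi> i. 2 ^ CARD('n))"
      using nonneg by (simp add: mem_box_cart)
  qed
qed

theorem theorem1:
  shows "polytope (R2 \<inter> R3 :: (real^'n::{finite,linorder}) set) \<and>
    (pure_sector_vectors :: (real^'n::{finite,linorder}) set) \<subseteq> R2 \<inter> R3"
proof
  have "bounded (R2 \<inter> R3 :: (real^'n::{finite,linorder}) set)"
    by (rule bounded_subset[OF bounded_R1]) (auto simp: R2_def Let_def)
  then show "polytope (R2 \<inter> R3 :: (real^'n::{finite,linorder}) set)"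
    unfolding polytope_eq_bounded_polyhedron by (simp add: polyhedron_R2 polyhedron_R3)
  show "(pure_sector_vectors :: (real^'n::{finite,linorder}) set) \<subseteq> R2 \<inter> R3"
    by (auto simp: pure_sector_vectors_def pure_sector_vector_in_R2 pure_sector_vector_in_R3)
qed

end
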